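(* Let $d=1$, $T=2$, $z_0=0$, $\mathcal{R}(v)=|v|$, $\mathcal{E}(z)=\tfrac12 z^2-z$. For $n\in\mathbb{N}$, $n\ge 1$, let $$\ell_n(t)=\begin{cases}0,&t\in[0,1],\\ \tfrac n2 t-\tfrac n2,&t\in(1,1+\tfrac1n),\\ \tfrac12,&t\in[1+\tfrac1n,2],\end{cases}\qquad \ell(t)=\begin{cases}0,&t\in[0,1],\\ \tfrac12,&t\in(1,2],\end{cases}$$ and let $S=\tfrac52$ and $a_n:=\frac{n/2}{1+n/2}$, $$\hat z_n(s)=\hat\ell_n(s)=\begin{cases}0,&s\in[0,1],\\ a_n s-a_n,&s\in(1,\tfrac32+\tfrac1n),\\ \tfrac12,&s\in[\tfrac32+\tfrac1n,\tfrac52],\end{cases}\qquad \hat t_n(s)=\begin{cases}s,&s\in[0,1],\\ \frac{1}{1+n/2}\,s+a_n,&s\in(1,\tfrac32+\tfrac1n),\\ s-\tfrac12,&s\in[\tfrac32+\tfrac1n,\tfrac52],\end{cases}$$ $$\hat z(s)=\hat\ell(s)=\begin{cases}0,&s\in[0,1],\\ s-1,&s\in(1,\tfrac32),\\ \tfrac12,&s\in[\tfrac32,\tfrac52],\end{cases}\qquad \hat t(s)=\begin{cases}s,&s\in[0,1],\\ 1,&s\in(1,\tfrac32),\\ s-\tfrac12,&s\in[\tfrac32,\tfrac52].\end{cases}$$ Then: (i) $\ell_n\to\ell$ with respect to intermediate convergence in $BV([0,2])$; (ii) for every $n$, $(S,\hat t_n,\hat z_n,\hat\ell_n)$ is a normalized,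 $\mathfrak p$-parametrized BV solution associated with $\ell_n$; (iii) $\hat z_n\to\hat z$ and $\hat t_n\to\hat t$ strongly in $H^1(0,S)$ and weakly$*$ in $W^{1,\infty}(0,S)$, and $\hat\ell_n\to\hat\ell$ with respect to intermediate convergence in $BV([0,S])$; (iv) $(S,\hat t,\hat z,\hat\ell)$ is not a normalized, $\mathfrak p$-parametrized BV solution associated with $\ell$. In particular, the concept of normalized, $\mathfrak p$-parametrized BV solutions is not stable with respect to intermediate convergence of the loads.
   Context: $BV([0,T])$ is the set of functions $f:[0,T]\to\mathbb{R}$ (defined everywhere) with finite pointwise total variation $\mathrm{Var}(f;[0,T])$; each such $f$ is identified with its class in $\mathrm{BV}(0,T)=\{f\in L^1(0,T): Df\in\mathfrak{M}(0,T)\}$, where $Df$ is the distributional derivative, $\mathfrak{M}(0,T)$ the space of regular Borel measures on $(0,T)$, and $|Df|(0,T)$ the total variation of the measure $Df$. Intermediate convergence $f_n\to f$ means: $f_n\to f$ in $L^1(0,T)$, $Df_n\rightharpoonup^* Df$ in $\mathfrak{M}(0,T)$, and $|Df_n|(0,T)\to|Df|(0,T)$. $\partial\mathcal{R}(0)$ is the convex subdifferential of $\mathcal{R}$ at $0$ (here $[-1,1]$), $\operatorname{dist}(w,\partial\mathcal{R}(0))$ the distance of $w$ to this set. For a load $\hat\ell$ on $[0,S]$ put $\hat{\mathcal I}(s,z)=\mathcal{E}(z)-\hat\ell(s)z$. $W^{1,\infty}$ functions are identified with their continuous representatives. Given $\ell\in BV([0,T])$, a tuple $(S,\hat t,\hat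 z,\hat\ell)\in(0,\infty)\times W^{1,\infty}(0,S)\times W^{1,\infty}(0,S)\times BV([0,S])$ is a normalized, $\mathfrak p$-parametrized (balanced viscosity, BV) solution associated with $\ell$ (with initial value $z_0$) if: (1) $\hat t(0)=0$, $\hat t(S)=T$, $\hat z(0)=z_0$; (2) for almost all $s\in(0,S)$: $\hat t'(s)\ge0$, $\hat t'(s)\operatorname{dist}(-D_z\hat{\mathcal I}(s,\hat z(s)),\partial\mathcal R(0))=0$, and $\hat t'(s)+\mathcal R(\hat z'(s))+|\hat z'(s)|\operatorname{dist}(-D_z\hat{\mathcal I}(s,\hat z(s)),\partial\mathcal R(0))=1$; (3) for all $s_1,s_2\in[0,S]$: $\mathcal E(\hat z(s_2))+\int_{s_1}^{s_2}\mathcal R(\hat z'(r))+|\hat z'(r)|\operatorname{dist}(-D_z\hat{\mathcal I}(r,\hat z(r)),\partial\mathcal R(0))\,dr=\mathcal E(\hat z(s_1))+\int_{s_1}^{s_2}\hat\ell(r)\hat z'(r)\,dr$; (4) for every $t_*\in[0,T]$ there exists $s_*\in\hat t^{-1}(t_* )$ such that for all $s\in\hat t^{-1}(t_* )$: $\hat\ell(s)=\ell(t_*-)$ if $s<s_*$, $\hat\ell(s)=\ell(t_*+)$ if $s>s_*$, and $\hat\ell(s_* )\in\{\ell(t_* ),\ell(t_*-),\ell(t_*+)\}$. Here $\ell(t\pm)$ are one-sided limits, with $\ell(0-):=\ell(0)$ and $\ell(T+):=\ell(T)$. *)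

theory Defs
  imports "HOL-Analysis.Analysis"
begin

text \<open>
  A finite signed measure is a real-valued, countably additive set function. The measure
  argument \<open>M\<close> only contributes its underlying space and sigma-algebra. On an open interval every
  finite signed Borel measure is automatically regular, so these set functions (up to their values
  on non-measurable sets) are exactly the regular Borel measures.
\<close>

definition signed_measure :: "'a measure \<Rightarrow> ('a set \<Rightarrow> real) \<Rightarrow> bool" where
  "signed_measure M \<mu> \<longleftrightarrow> \<mu> {} = 0 \<and>
     (\<forall>A :: nat \<Rightarrow> 'a set. range A \<subseteq> sets M \<and> disjoint_family A \<longrightarrow>
        (\<lambda>i. \<mu> (A i)) sums \<mu> (\<Union>i. A i))"

definition variation :: "'a measure \<Rightarrow> ('a set \<Rightarrow> real) \<Rightarrow> 'a set \<Rightarrow> ennreal" where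
  "variation M \<mu> B =
     (SUP A \<in> {A :: nat \<Rightarrow> 'a set. range A \<subseteq> sets M \<and> disjoint_family A \<and> (\<Union>i. A i) = B}.
        \<Sum>i. ennreal \<bar>\<mu> (A i)\<bar>)"

text \<open>
  Jordan decomposition. The variation of a finite signed measure is finite, so the truncating
  conversion \<open>enn2real\<close> loses nothing.
\<close>

definition jordan_pos :: "'a measure \<Rightarrow> ('a set \<Rightarrow> real) \<Rightarrow> 'a measure" where
  "jordan_pos M \<mu> = measure_of (space M) (sets M)
     (\<lambda>B. ennreal ((enn2real (variation M \<mu> B) + \<mu> B) / 2))"

definition jordan_neg :: "'a measure \<Rightarrow> ('a set \<Rightarrow> real) \<Rightarrow> 'a measure" where
  "jordan_neg M \<mu> = measure_of (space M) (sets M)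
     (\<lambda>B. ennreal ((enn2real (variation M \<mu> B) - \<mu> B) / 2))"

definition signed_integral :: "'a measure \<Rightarrow> ('a set \<Rightarrow> real) \<Rightarrow> ('a \<Rightarrow> real) \<Rightarrow> real" where
  "signed_integral M \<mu> f = integral\<^sup>L (jordan_pos M \<mu>) f - integral\<^sup>L (jordan_neg M \<mu>) f"

abbreviation borel_on :: "real \<Rightarrow> real \<Rightarrow> real measure" where
  "borel_on a b \<equiv> restrict_space borel {a<..<b}"

definition C0_on :: "real \<Rightarrow> real \<Rightarrow> (real \<Rightarrow> real) \<Rightarrow> bool" where
  "C0_on a b \<phi> \<longleftrightarrow> continuous_on {a<..<b} \<phi> \<and>
     (\<forall>\<epsilon>>0. \<exists>K. compact K \<and> K \<subseteq> {a<..<b} \<and> (\<forall>x\<in>{a<..<b} - K. \<bar>\<phi> x\<bar> < \<epsilon>))"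

definition measures_weak_star_conv ::
    "real \<Rightarrow> real \<Rightarrow> (nat \<Rightarrow> real set \<Rightarrow> real) \<Rightarrow> (real set \<Rightarrow> real) \<Rightarrow> bool" where
  "measures_weak_star_conv a b \<mu>s \<mu> \<longleftrightarrow>
     (\<forall>\<phi>. C0_on a b \<phi> \<longrightarrow>
        (\<lambda>n. signed_integral (borel_on a b) (\<mu>s n) \<phi>)
          \<longlonglongrightarrow> signed_integral (borel_on a b) \<mu> \<phi>)"

definition test_function :: "real \<Rightarrow> real \<Rightarrow> (real \<Rightarrow> real) \<Rightarrow> bool" where
  "test_function a b \<phi> \<longleftrightarrow>
     (\<forall>k x. ((deriv ^^ k) \<phi>) differentiable (at x)) \<and>
     (\<exists>K. compact K \<and> K \<subseteq> {a<..<b} \<and> (\<forall>x. x \<notin> K \<longrightarrow> \<phi> x = 0))"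

definition has_measure_deriv ::
    "real \<Rightarrow> real \<Rightarrow> (real \<Rightarrow> real) \<Rightarrow> (real set \<Rightarrow> real) \<Rightarrow> bool" where
  "has_measure_deriv a b f \<mu> \<longleftrightarrow>
     integrable (lebesgue_on {a<..<b}) f \<and> signed_measure (borel_on a b) \<mu> \<and>
     (\<forall>\<phi>. test_function a b \<phi> \<longrightarrow>
        (LINT x|lebesgue_on {a<..<b}. f x * deriv \<phi> x) = - signed_integral (borel_on a b) \<mu> \<phi>)"

definition has_weak_deriv ::
    "real \<Rightarrow> real \<Rightarrow> (real \<Rightarrow> real) \<Rightarrow> (real \<Rightarrow> real) \<Rightarrow> bool" where
  "has_weak_deriv a b f g \<longleftrightarrow>
     integrable (lebesgue_on {a<..<b}) f \<and> integrable (lebesgue_on {a<..<b}) g \<and>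
     (\<forall>\<phi>. test_function a b \<phi> \<longrightarrow>
        (LINT x|lebesgue_on {a<..<b}. f x * deriv \<phi> x)
          = - (LINT x|lebesgue_on {a<..<b}. g x * \<phi> x))"

definition BV_on :: "real \<Rightarrow> real \<Rightarrow> (real \<Rightarrow> real) \<Rightarrow> bool" where
  "BV_on a b f \<longleftrightarrow>
     (\<exists>C. \<forall>(p :: nat \<Rightarrow> real) m.
        p ` {..m} \<subseteq> {a..b} \<and> mono_on {..m} p \<longrightarrow> (\<Sum>i<m. \<bar>f (p (Suc i)) - f (p i)\<bar>) \<le> C)"

definition L1_conv ::
    "real \<Rightarrow> real \<Rightarrow> (nat \<Rightarrow> real \<Rightarrow> real) \<Rightarrow> (real \<Rightarrow> real) \<Rightarrow> bool" where
  "L1_conv a b fs f \<longleftrightarrow>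
     (\<forall>n. integrable (lebesgue_on {a<..<b}) (fs n)) \<and> integrable (lebesgue_on {a<..<b}) f \<and>
     (\<lambda>n. LINT x|lebesgue_on {a<..<b}. \<bar>fs n x - f x\<bar>) \<longlonglongrightarrow> 0"

text \<open>
  The derivative measures \<open>\<nu>s n\<close> and \<open>\<nu>\<close> below are unique as measures, hence the existential
  quantifier merely names them.
\<close>

definition intermediate_conv ::
    "real \<Rightarrow> (nat \<Rightarrow> real \<Rightarrow> real) \<Rightarrow> (real \<Rightarrow> real) \<Rightarrow> bool" where
  "intermediate_conv T fs f \<longleftrightarrow>
     (\<forall>n. BV_on 0 T (fs n)) \<and> BV_on 0 T f \<and> L1_conv 0 T fs f \<and>
     (\<exists>\<nu>s \<nu>. (\<forall>n. has_measure_deriv 0 T (fs n) (\<nu>s n)) \<and> has_measure_deriv 0 T f \<nu> \<and>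
        measures_weak_star_conv 0 T \<nu>s \<nu> \<and>
        (\<lambda>n. variation (borel_on 0 T) (\<nu>s n) {0<..<T}) \<longlonglongrightarrow> variation (borel_on 0 T) \<nu> {0<..<T})"

definition L2_fun :: "real \<Rightarrow> (real \<Rightarrow> real) \<Rightarrow> bool" where
  "L2_fun S f \<longleftrightarrow> f \<in> borel_measurable (lebesgue_on {0<..<S}) \<and>
     integrable (lebesgue_on {0<..<S}) (\<lambda>x. (f x)\<^sup>2)"

definition Linf_fun :: "real \<Rightarrow> (real \<Rightarrow> real) \<Rightarrow> bool" where
  "Linf_fun S f \<longleftrightarrow> f \<in> borel_measurable (lebesgue_on {0<..<S}) \<and>
     (\<exists>C. AE x in lebesgue_on {0<..<S}. \<bar>f x\<bar> \<le> C)"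

definition H1_deriv :: "real \<Rightarrow> (real \<Rightarrow> real) \<Rightarrow> (real \<Rightarrow> real) \<Rightarrow> bool" where
  "H1_deriv S f f' \<longleftrightarrow> L2_fun S f \<and> L2_fun S f' \<and> has_weak_deriv 0 S f f'"

text \<open>
  The function \<open>f\<close> is the continuous representative of an element of \<open>W^{1,\<infinity>}(0,S)\<close>, and \<open>f'\<close>
  is a representative of its weak derivative.
\<close>

definition W1inf_deriv :: "real \<Rightarrow> (real \<Rightarrow> real) \<Rightarrow> (real \<Rightarrow> real) \<Rightarrow> bool" where
  "W1inf_deriv S f f' \<longleftrightarrow>
     continuous_on {0..S} f \<and> Linf_fun S f \<and> Linf_fun S f' \<and> has_weak_deriv 0 S f f'"

definition H1_conv :: "real \<Rightarrow> (nat \<Rightarrow> real \<Rightarrow> real) \<Rightarrow> (real \<Rightarrow> real) \<Rightarrow> bool" where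
  "H1_conv S fs f \<longleftrightarrow>
     (\<exists>gs g. (\<forall>n. H1_deriv S (fs n) (gs n)) \<and> H1_deriv S f g \<and>
        (\<lambda>n. (LINT x|lebesgue_on {0<..<S}. (fs n x - f x)\<^sup>2)
            + (LINT x|lebesgue_on {0<..<S}. (gs n x - g x)\<^sup>2)) \<longlonglongrightarrow> 0)"

definition Linf_weak_star_conv ::
    "real \<Rightarrow> (nat \<Rightarrow> real \<Rightarrow> real) \<Rightarrow> (real \<Rightarrow> real) \<Rightarrow> bool" where
  "Linf_weak_star_conv S fs f \<longleftrightarrow>
     (\<forall>h. integrable (lebesgue_on {0<..<S}) h \<longrightarrow>
        (\<lambda>n. LINT x|lebesgue_on {0<..<S}. fs n x * h x)
          \<longlonglongrightarrow> (LINT x|lebesgue_on {0<..<S}. f x * h x))"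

definition W1inf_weak_star_conv ::
    "real \<Rightarrow> (nat \<Rightarrow> real \<Rightarrow> real) \<Rightarrow> (real \<Rightarrow> real) \<Rightarrow> bool" where
  "W1inf_weak_star_conv S fs f \<longleftrightarrow>
     (\<exists>gs g. (\<forall>n. W1inf_deriv S (fs n) (gs n)) \<and> W1inf_deriv S f g \<and>
        Linf_weak_star_conv S fs f \<and> Linf_weak_star_conv S gs g)"

definition subdifferential :: "(real \<Rightarrow> real) \<Rightarrow> real \<Rightarrow> real set" where
  "subdifferential R w = {\<xi>. \<forall>v. R w + \<xi> * (v - w) \<le> R v}"

definition left_lim :: "(real \<Rightarrow> real) \<Rightarrow> real \<Rightarrow> real" where
  "left_lim f t = (if t = 0 then f 0 else Lim (at_left t) f)"

definition right_lim :: "real \<Rightarrow> (real \<Rightarrow> real) \<Rightarrow> real \<Rightarrow> real" where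
  "right_lim T f t = (if t = T then f T else Lim (at_right t) f)"

text \<open>The distance of \<open>-D\<^sub>zI(s,z)\<close> to the subdifferential of \<open>R\<close> at 0, for \<open>I(s,z) = E(z) - l(s) z\<close>.\<close>

definition force_dist ::
    "(real \<Rightarrow> real) \<Rightarrow> (real \<Rightarrow> real) \<Rightarrow> (real \<Rightarrow> real) \<Rightarrow> real \<Rightarrow> real \<Rightarrow> real" where
  "force_dist E R l s z = infdist (- deriv (\<lambda>y. E y - l s * y) z) (subdifferential R 0)"

definition BV_solution ::
    "real \<Rightarrow> real \<Rightarrow> (real \<Rightarrow> real) \<Rightarrow> (real \<Rightarrow> real) \<Rightarrow> (real \<Rightarrow> real) \<Rightarrow>
     real \<Rightarrow> (real \<Rightarrow> real) \<Rightarrow> (real \<Rightarrow> real) \<Rightarrow> (real \<Rightarrow> real) \<Rightarrow> bool" where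
  "BV_solution T z0 E R load S t z l \<longleftrightarrow>
     BV_on 0 T load \<and> 0 < S \<and> BV_on 0 S l \<and>
     (\<exists>t' z'. W1inf_deriv S t t' \<and> W1inf_deriv S z z' \<and>
        t 0 = 0 \<and> t S = T \<and> z 0 = z0 \<and>
        (AE s in lebesgue_on {0<..<S}.
           0 \<le> t' s \<and> t' s * force_dist E R l s (z s) = 0 \<and>
           t' s + R (z' s) + \<bar>z' s\<bar> * force_dist E R l s (z s) = 1) \<and>
        (\<forall>s1\<in>{0..S}. \<forall>s2\<in>{0..S}.
           E (z s2) + interval_lebesgue_integral lebesgue (ereal s1) (ereal s2)
                        (\<lambda>r. R (z' r) + \<bar>z' r\<bar> * force_dist E R l r (z r))
           = E (z s1) + interval_lebesgue_integral lebesgue (ereal s1) (ereal s2)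
                        (\<lambda>r. l r * z' r)) \<and>
        (\<forall>ts\<in>{0..T}. \<exists>ss\<in>{s \<in> {0..S}. t s = ts}.
           l ss \<in> {load ts, left_lim load ts, right_lim T load ts} \<and>
           (\<forall>s\<in>{s \<in> {0..S}. t s = ts}.
              (s < ss \<longrightarrow> l s = left_lim load ts) \<and>
              (s > ss \<longrightarrow> l s = right_lim T load ts))))"

text \<open>
  The solutions converge in all the senses below and \<open>S\<close> is kept fixed, so this is a weak version of
  stability, and its failure is correspondingly a strong negative statement.
\<close>

definition stable_intermediate ::
    "real \<Rightarrow> real \<Rightarrow> (real \<Rightarrow> real) \<Rightarrow> (real \<Rightarrow> real) \<Rightarrow> bool" where
  "stable_intermediate T z0 E R \<longleftrightarrow>
     (\<forall>loads load S ts t zs z ls l.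
        intermediate_conv T loads load \<and>
        (\<forall>n. BV_solution T z0 E R (loads n) S (ts n) (zs n) (ls n)) \<and>
        H1_conv S zs z \<and> W1inf_weak_star_conv S zs z \<and>
        H1_conv S ts t \<and> W1inf_weak_star_conv S ts t \<and>
        intermediate_conv S ls l
        \<longrightarrow> BV_solution T z0 E R load S t z l)"

definition energy :: "real \<Rightarrow> real" where
  "energy z = 1/2 * z\<^sup>2 - z"

definition dissip :: "real \<Rightarrow> real" where
  "dissip v = \<bar>v\<bar>"

definition load_n :: "nat \<Rightarrow> real \<Rightarrow> real" where
  "load_n n t = (if t \<le> 1 then 0
                 else if t < 1 + 1 / real n then real n / 2 * t - real n / 2
                 else 1/2)"

definition load_lim :: "real \<Rightarrow> real" where
  "load_lim t = (if t \<le> 1 then 0 else 1/2)"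

definition a_n :: "nat \<Rightarrow> real" where
  "a_n n = (real n / 2) / (1 + real n / 2)"

definition zhat_n :: "nat \<Rightarrow> real \<Rightarrow> real" where
  "zhat_n n s = (if s \<le> 1 then 0
                 else if s < 3/2 + 1 / real n then a_n n * s - a_n n
                 else 1/2)"

definition lhat_n :: "nat \<Rightarrow> real \<Rightarrow> real" where
  "lhat_n n = zhat_n n"

definition that_n :: "nat \<Rightarrow> real \<Rightarrow> real" where
  "that_n n s = (if s \<le> 1 then s
                 else if s < 3/2 + 1 / real n then 1 / (1 + real n / 2) * s + a_n n
                 else s - 1/2)"

definition zhat_lim :: "real \<Rightarrow> real" where
  "zhat_lim s = (if s \<le> 1 then 0 else if s < 3/2 then s - 1 else 1/2)"

definition lhat_lim :: "real \<Rightarrow> real" where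
  "lhat_lim = zhat_lim"

definition that_lim :: "real \<Rightarrow> real" where
  "that_lim s = (if s \<le> 1 then s else if s < 3/2 then 1 else s - 1/2)"

end

theory Submission
  imports Defs "HOL-Probability.Giry_Monad"
begin

text \<open>
  Each function in the example, apart from the discontinuous limit load, is a broken line: the
  primitive, vanishing at 0, of a step function with three values. Hence the slopes are weak
  derivatives, and since those of loads and states are nonnegative they are also densities of the
  derivative measures (\<open>bounded_primitive.weak_deriv\<close>, \<open>bounded_primitive.measure_deriv\<close>). All
  measures that occur are therefore nonnegative, and total variation and integration reduce to the
  usual notions (\<open>variation_measure\<close>, \<open>signed_integral_measure\<close>).

  The loads are ramps of height \<open>1/2\<close> over an interval of length \<open>1/n\<close>. Their slopes form an approximate
  identity at 1, which gives intermediate convergence to the jump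
  (\<open>steepening_ramp.ramp_intermediate_conv\<close>). The reparametrized functions have uniformly bounded,
  pointwise convergent slopes, so the convergence claims for them are instances of dominated
  convergence (locale \<open>broken_line_sequence\<close>).

  For each \<open>n\<close> the state equals the parametrized load, so the driving force sits at the boundary of the
  elastic range \<open>[-1, 1]\<close>, the viscous term vanishes, and the energy balance is the chain rule. As
  \<open>that_n\<close> is strictly increasing and the parametrized load is \<open>load_n n \<circ> that_n n\<close>, the load
  condition holds (\<open>BV_solution_n\<close>). In the limit time stands still on the parameter interval
  \<open>[1, 3/2]\<close>, while the limit of the parametrized loads still rises continuously from 0 to \<open>1/2\<close>: it
  remembers the ramp. A solution for the jumping load would have to jump between its one-sided
  limits at one parameter, so the limit is not a solution (\<open>not_BV_solution_lim\<close>), and stability fails.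
\<close>

section \<open>Finite measures as signed measures\<close>

text \<open>
  For a nonnegative measure the supremum over partitions is attained by every partition. Since all
  functions of the example are nondecreasing, their derivatives are of this kind, and the Jordan
  decomposition collapses: integration against the signed measure is integration against the measure.
\<close>

lemma variation_measure:
  assumes "finite_measure N" and sets: "sets N = sets M" and B: "B \<in> sets M"
  shows "variation M (measure N) B = emeasure N B"
proof -
  interpret finite_measure N by fact
  have eq: "(\<Sum>i. ennreal \<bar>measure N (A i)\<bar>) = emeasure N B"
    if "range A \<subseteq> sets M" "disjoint_family A" "(\<Union>i. A i) = B" for A :: "nat \<Rightarrow> 'a set"
  proof -
    have "(\<Sum>i. ennreal \<bar>measure N (A i)\<bar>) = (\<Sum>i. emeasure N (A i))"
      by (simp only: emeasure_eq_measure abs_of_nonneg measure_nonneg)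
    also have "\<dots> = emeasure N B"
      using suminf_emeasure[of A N] that sets by (simp only:)
    finally show ?thesis .
  qed
  let ?A = "\<lambda>i::nat. if i = 0 then B else {}"
  have "range ?A \<subseteq> sets M" "disjoint_family ?A"
    using B by (fastforce simp: disjoint_family_on_def)+
  moreover have "(\<Union>i. ?A i) = B"
  proof (intro equalityI subsetI)
    fix x assume "x \<in> B"
    then show "x \<in> (\<Union>i. ?A i)" by (intro UN_I[of 0]) simp_all
  next
    fix x assume "x \<in> (\<Union>i. ?A i)"
    then obtain i where "x \<in> ?A i" by (rule UN_E)
    then show "x \<in> B" by (cases "i = 0") simp_all
  qed
  ultimately show ?thesis
    unfolding variation_def by (intro SUP_eq_const) (use eq in blast)+
qed

lemma signed_measure_measure:
  assumes "finite_measure N" and sets: "sets N = sets M"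
  shows "signed_measure M (measure N)"
proof -
  interpret finite_measure N by fact
  show ?thesis
    unfolding signed_measure_def
    using finite_measure_UNION by (simp add: sets[symmetric])
qed

lemma jordan_pos_measure:
  assumes "finite_measure N" and sets: "sets N = sets M"
  shows "jordan_pos M (measure N) = N"
proof -
  interpret finite_measure N by fact
  have "jordan_pos M (measure N) = measure_of (space M) (sets M) (emeasure N)"
    unfolding jordan_pos_def
  proof (rule measure_of_eq[OF sets.space_closed])
    fix B assume "B \<in> sigma_sets (space M) (sets M)"
    then have "variation M (measure N) B = ennreal (measure N B)"
      using variation_measure[OF assms, of B] by (simp only: sets.sigma_sets_eq emeasure_eq_measure)
    then show "ennreal ((enn2real (variation M (measure N) B) + measure N B) / 2) = emeasure N B"
      by (simp add: emeasure_eq_measure)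
  qed
  also have "\<dots> = N"
    by (metis measure_of_of_measure sets sets_eq_imp_space_eq)
  finally show ?thesis .
qed

lemma jordan_neg_measure:
  assumes "finite_measure N" and sets: "sets N = sets M"
  shows "jordan_neg M (measure N) = null_measure M"
proof -
  interpret finite_measure N by fact
  have "jordan_neg M (measure N) = measure_of (space M) (sets M) (emeasure (null_measure M))"
    unfolding jordan_neg_def
  proof (rule measure_of_eq[OF sets.space_closed])
    fix B assume "B \<in> sigma_sets (space M) (sets M)"
    then have "variation M (measure N) B = ennreal (measure N B)"
      using variation_measure[OF assms, of B] by (simp only: sets.sigma_sets_eq emeasure_eq_measure)
    then show "ennreal ((enn2real (variation M (measure N) B) - measure N B) / 2) = emeasure (null_measure M) B"
      by (simp add: emeasure_eq_measure)
  qed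
  also have "\<dots> = null_measure M"
    by (metis measure_of_of_measure sets_null_measure space_null_measure)
  finally show ?thesis .
qed

lemma signed_integral_measure:
  assumes "finite_measure N" "sets N = sets M"
  shows "signed_integral M (measure N) f = integral\<^sup>L N f"
  by (simp add: signed_integral_def jordan_pos_measure[OF assms] jordan_neg_measure[OF assms])

section \<open>Integration on a bounded interval\<close>

lemma finite_measure_Ioo: "finite_measure (lebesgue_on {a<..<b::real})"
  by (rule finite_measure_lebesgue_on) (metis box_real(1) lmeasurable_box)

lemma Ioo_in_sets_borel_on: "{a<..<b} \<in> sets (borel_on a b)"
  using sets.top[of "borel_on a b"] by (simp add: space_restrict_space)

lemma borel_measurable_lebesgue_on:
  "f \<in> borel_measurable borel \<Longrightarrow> f \<in> borel_measurable (lebesgue_on S)"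
  by (simp add: measurable_completion measurable_restrict_space1)

lemma integrable_bounded_Ioo:
  fixes f :: "real \<Rightarrow> real"
  assumes "f \<in> borel_measurable (lebesgue_on {a<..<b})" "\<And>x. x \<in> {a<..<b} \<Longrightarrow> \<bar>f x\<bar> \<le> C"
  shows "integrable (lebesgue_on {a<..<b}) f"
proof -
  interpret finite_measure "lebesgue_on {a<..<b}" by (rule finite_measure_Ioo)
  show ?thesis
    by (rule integrable_const_bound[of _ C]) (use assms in auto)
qed

lemma borel_on_imp_lebesgue_on:
  fixes f :: "real \<Rightarrow> real"
  assumes "f \<in> borel_measurable (borel_on a b)"
  shows "f \<in> borel_measurable (lebesgue_on {a<..<b})"
proof -
  have "(\<lambda>x. indicator {a<..<b} x *\<^sub>R f x) \<in> borel_measurable borel"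
    using assms by (simp add: borel_measurable_restrict_space_iff)
  then have "(\<lambda>x. indicator {a<..<b} x *\<^sub>R f x) \<in> borel_measurable lebesgue"
    by (simp add: measurable_completion)
  then show ?thesis
    by (subst borel_measurable_restrict_space_iff) auto
qed

lemma measurable_lborel_on:
  "borel_measurable (restrict_space lborel {a<..<b}) = (borel_measurable (borel_on a b) :: (real \<Rightarrow> real) set)"
  by (rule measurable_cong_sets[OF sets_restrict_space_cong[OF sets_lborel] refl])

text \<open>
  Derivative measures live on the Borel sets of the interval, while integrals of functions are taken
  against the complete Lebesgue measure; for Borel integrands the two integrals coincide.
\<close>

lemma integral_restrict_lborel:
  fixes f :: "real \<Rightarrow> real"
  assumes "f \<in> borel_measurable (borel_on a b)"
  shows "integral\<^sup>L (restrict_space lborel {a<..<b}) f = integral\<^sup>L (lebesgue_on {a<..<b}) f"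
proof -
  have "(\<lambda>x. indicator {a<..<b} x *\<^sub>R f x) \<in> borel_measurable lborel"
    using assms by (simp add: borel_measurable_restrict_space_iff)
  then show ?thesis
    by (simp add: integral_restrict_space integral_completion)
qed

text \<open>
  A continuous function with bounded derivative off a finite set is recovered by the Lebesgue integral
  of that derivative: the Henstock--Kurzweil fundamental theorem tolerates the exceptional points, and
  boundedness turns the integral into a Lebesgue integral. Integration by parts, the
  chain rule and total increments below are instances.
\<close>

lemma lebesgue_integral_FTC_Ioo:
  fixes F :: "real \<Rightarrow> real"
  assumes "finite K" "a \<le> b" "continuous_on {a..b} F"
    and "\<And>x. x \<in> {a<..<b} - K \<Longrightarrow> (F has_real_derivative F' x) (at x)"
    and "F' \<in> borel_measurable (lebesgue_on {a<..<b})" "\<And>x. x \<in> {a<..<b} \<Longrightarrow> \<bar>F' x\<bar> \<le> C"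
  shows "(LINT x|lebesgue_on {a<..<b}. F' x) = F b - F a"
proof -
  have "(F' has_integral F b - F a) {a..b}"
    using assms by (intro fundamental_theorem_of_calculus_interior_strong[of K])
      (auto simp: has_real_derivative_iff_has_vector_derivative)
  then have "(F' has_integral F b - F a) {a<..<b}"
    by (simp add: has_integral_Icc_iff_Ioo)
  then show ?thesis
    using lebesgue_integral_eq_integral[OF integrable_bounded_Ioo[OF assms(5,6)]]
    by (simp add: integral_unique)
qed

section \<open>Test functions\<close>

lemma test_function_props:
  assumes "test_function a b \<phi>"
  shows "\<And>x. (\<phi> has_real_derivative deriv \<phi> x) (at x)"
    and "continuous_on UNIV \<phi>" and "continuous_on UNIV (deriv \<phi>)"
    and "\<And>x. x \<notin> {a<..<b} \<Longrightarrow> \<phi> x = 0"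
proof -
  have d: "((deriv ^^ k) \<phi>) differentiable (at x)" for k x
    using assms by (simp add: test_function_def)
  show "(\<phi> has_real_derivative deriv \<phi> x) (at x)" for x
    using d[of 0 x] by (simp add: DERIV_deriv_iff_real_differentiable)
  show "continuous_on UNIV \<phi>"
    using d[of 0] by (auto simp: continuous_on_eq_continuous_at intro: differentiable_imp_continuous_within)
  show "continuous_on UNIV (deriv \<phi>)"
    using d[of 1] by (auto simp: continuous_on_eq_continuous_at intro: differentiable_imp_continuous_within)
  show "\<And>x. x \<notin> {a<..<b} \<Longrightarrow> \<phi> x = 0"
    using assms by (auto simp: test_function_def)
qed

lemma continuous_bounded_Icc:
  fixes f :: "real \<Rightarrow> real"
  assumes "continuous_on UNIV f"
  shows "\<exists>C. \<forall>x\<in>{a..b}. \<bar>f x\<bar> \<le> C"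
proof -
  have "bounded (f ` {a..b})"
    using assms compact_continuous_image compact_imp_bounded continuous_on_subset
    by (metis compact_Icc subset_UNIV)
  then show ?thesis by (auto simp: bounded_iff)
qed

lemma C0_on_bounded:
  assumes "C0_on a b \<phi>"
  shows "\<exists>C. \<forall>x\<in>{a<..<b}. \<bar>\<phi> x\<bar> \<le> C"
proof -
  obtain K where K: "compact K" "K \<subseteq> {a<..<b}" "\<forall>x\<in>{a<..<b} - K. \<bar>\<phi> x\<bar> < 1"
    using assms unfolding C0_on_def by (metis zero_less_one)
  have "bounded (\<phi> ` K)"
    using assms K compact_continuous_image compact_imp_bounded continuous_on_subset
    unfolding C0_on_def by metis
  then obtain C where C: "\<forall>x\<in>K. \<bar>\<phi> x\<bar> \<le> C" by (auto simp: bounded_iff)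
  have "\<bar>\<phi> x\<bar> \<le> max C 1" if "x \<in> {a<..<b}" for x
    using C K(3) that by (cases "x \<in> K") (auto simp: le_max_iff_disj less_imp_le)
  then show ?thesis by blast
qed

lemma C0_on_measurable:
  "C0_on a b \<phi> \<Longrightarrow> \<phi> \<in> borel_measurable (borel_on a b)"
  unfolding C0_on_def by (simp add: borel_measurable_continuous_on_restrict)

lemma C0_on_integrable:
  assumes "C0_on a b \<phi>"
  shows "integrable (lebesgue_on {a<..<b}) \<phi>"
  using C0_on_bounded[OF assms]
    integrable_bounded_Ioo[OF borel_on_imp_lebesgue_on[OF C0_on_measurable[OF assms]]] by blast

section \<open>Primitives of bounded functions\<close>

abbreviation slope_measure :: "real \<Rightarrow> real \<Rightarrow> (real \<Rightarrow> real) \<Rightarrow> real measure" where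
  "slope_measure a b g \<equiv> density (restrict_space lborel {a<..<b}) (\<lambda>x. ennreal (g x))"

text \<open>
  The setting of the piecewise linear functions: \<open>f\<close> has bounded derivative \<open>g\<close> off the finite set \<open>K\<close>,
  so \<open>g\<close> is both the weak derivative of \<open>f\<close> and, when nonnegative, the density of its derivative measure.
\<close>

locale bounded_primitive =
  fixes a b :: real and f g :: "real \<Rightarrow> real" and K :: "real set" and C :: real
  assumes ab: "a \<le> b" and K: "finite K" and cont: "continuous_on UNIV f"
    and der: "\<And>x. x \<notin> K \<Longrightarrow> (f has_real_derivative g x) (at x)"
    and meas: "g \<in> borel_measurable borel" and bd: "\<And>x. \<bar>g x\<bar> \<le> C"
begin

lemma f_measurable: "f \<in> borel_measurable borel"
  using cont by (rule borel_measurable_continuous_onI)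

lemma f_bounded: "\<exists>B. \<forall>x\<in>{a..b}. \<bar>f x\<bar> \<le> B"
  using cont by (rule continuous_bounded_Icc)

text \<open>
  Integration by parts: the fundamental theorem applied to \<open>f\<close> times the test function, which vanishes
  at both ends of the interval.
\<close>

lemma weak_deriv: "has_weak_deriv a b f g"
  unfolding has_weak_deriv_def
proof (intro conjI allI impI)
  obtain B where B: "\<And>x. x \<in> {a..b} \<Longrightarrow> \<bar>f x\<bar> \<le> B" using f_bounded by blast
  show "integrable (lebesgue_on {a<..<b}) f"
    by (rule integrable_bounded_Ioo[where C = B])
      (use B in \<open>auto intro: borel_measurable_lebesgue_on f_measurable\<close>)
  show "integrable (lebesgue_on {a<..<b}) g"
    by (rule integrable_bounded_Ioo[where C = C])
      (use bd in \<open>auto intro: borel_measurable_lebesgue_on meas\<close>)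
  fix \<phi> assume "test_function a b \<phi>"
  note \<phi> = test_function_props[OF this]
  obtain P where P: "\<And>x. x \<in> {a..b} \<Longrightarrow> \<bar>\<phi> x\<bar> \<le> P"
    using continuous_bounded_Icc[OF \<phi>(2)] by blast
  obtain Q where Q: "\<And>x. x \<in> {a..b} \<Longrightarrow> \<bar>deriv \<phi> x\<bar> \<le> Q"
    using continuous_bounded_Icc[OF \<phi>(3)] by blast
  have [measurable]: "\<phi> \<in> borel_measurable borel" "deriv \<phi> \<in> borel_measurable borel"
    "f \<in> borel_measurable borel" "g \<in> borel_measurable borel"
    using \<phi> meas f_measurable by (auto intro: borel_measurable_continuous_onI)
  have b1: "\<bar>f x * deriv \<phi> x\<bar> \<le> B * Q" and b2: "\<bar>g x * \<phi> x\<bar> \<le> C * P" if "x \<in> {a<..<b}" for x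
    using B[of x] Q[of x] P[of x] bd[of x] that by (auto simp: abs_mult intro!: mult_mono)
  have i1: "integrable (lebesgue_on {a<..<b}) (\<lambda>x. f x * deriv \<phi> x)"
    by (rule integrable_bounded_Ioo[OF _ b1]) (auto intro!: borel_measurable_lebesgue_on)
  have i2: "integrable (lebesgue_on {a<..<b}) (\<lambda>x. g x * \<phi> x)"
    by (rule integrable_bounded_Ioo[OF _ b2]) (auto intro!: borel_measurable_lebesgue_on)
  have "(LINT x|lebesgue_on {a<..<b}. f x * deriv \<phi> x + g x * \<phi> x) = f b * \<phi> b - f a * \<phi> a"
  proof (rule lebesgue_integral_FTC_Ioo[OF K ab, where C = "B * Q + C * P"])
    show "continuous_on {a..b} (\<lambda>x. f x * \<phi> x)"
      using cont \<phi>(2) by (intro continuous_intros) (auto intro: continuous_on_subset)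
    show "((\<lambda>x. f x * \<phi> x) has_real_derivative f x * deriv \<phi> x + g x * \<phi> x) (at x)"
      if "x \<in> {a<..<b} - K" for x
      using DERIV_mult[OF der \<phi>(1)] that by (auto simp: algebra_simps)
    show "\<bar>f x * deriv \<phi> x + g x * \<phi> x\<bar> \<le> B * Q + C * P" if "x \<in> {a<..<b}" for x
      using b1[OF that] b2[OF that] by linarith
  qed (auto intro!: borel_measurable_lebesgue_on)
  moreover have "\<phi> a = 0" "\<phi> b = 0" using \<phi>(4) by auto
  ultimately show "(LINT x|lebesgue_on {a<..<b}. f x * deriv \<phi> x)
      = - (LINT x|lebesgue_on {a<..<b}. g x * \<phi> x)"
    using i1 i2 by simp
qed

lemma sets_slope_measure: "sets (slope_measure a b g) = sets (borel_on a b)"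
  unfolding sets_density by (rule sets_restrict_space_cong) (rule sets_lborel)

lemma integral_slope_measure:
  assumes "\<And>x. 0 \<le> g x" and \<phi>: "\<phi> \<in> borel_measurable (borel_on a b)"
  shows "integral\<^sup>L (slope_measure a b g) \<phi> = (LINT x|lebesgue_on {a<..<b}. g x * \<phi> x)"
proof -
  note m = measurable_lborel_on[of a b]
  have g: "g \<in> borel_measurable (borel_on a b)"
    using meas by (rule measurable_restrict_space1)
  then have gp: "(\<lambda>x. g x * \<phi> x) \<in> borel_measurable (borel_on a b)" using \<phi> by measurable
  have "integral\<^sup>L (slope_measure a b g) \<phi> = (LINT x|restrict_space lborel {a<..<b}. g x * \<phi> x)"
    using g \<phi> assms(1) by (subst integral_density) (auto simp: m)
  then show ?thesis using integral_restrict_lborel[OF gp] by simp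
qed

lemma integral_slope: "(LINT x|lebesgue_on {a<..<b}. g x) = f b - f a"
  using lebesgue_integral_FTC_Ioo[OF K ab _ _ borel_measurable_lebesgue_on[OF meas] bd] der cont
    continuous_on_subset by blast

lemma emeasure_slope_measure:
  assumes "\<And>x. 0 \<le> g x"
  shows "emeasure (slope_measure a b g) {a<..<b} = ennreal (f b - f a)"
proof -
  note m = measurable_lborel_on[of a b]
  have g: "g \<in> borel_measurable (borel_on a b)"
    using meas by (rule measurable_restrict_space1)
  have "integrable (lebesgue_on {a<..<b}) g" using weak_deriv by (simp add: has_weak_deriv_def)
  then have "integrable lborel (\<lambda>x. indicator {a<..<b} x *\<^sub>R g x)"
    using g by (subst (asm) integrable_restrict_space, simp)
      (subst (asm) integrable_completion, auto simp: borel_measurable_restrict_space_iff set_integrable_def)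
  then have gi: "integrable (restrict_space lborel {a<..<b}) g"
    by (simp add: integrable_restrict_space set_integrable_def)
  have "emeasure (slope_measure a b g) {a<..<b} = (\<integral>\<^sup>+ x. ennreal (g x) \<partial>restrict_space lborel {a<..<b})"
    using meas by (subst emeasure_density)
      (auto simp: m g space_restrict_space sets_restrict_space intro!: nn_integral_cong
         split: split_indicator intro: measurable_restrict_space1)
  also have "\<dots> = ennreal (integral\<^sup>L (restrict_space lborel {a<..<b}) g)"
    using gi assms by (intro nn_integral_eq_integral) auto
  finally show ?thesis by (simp add: integral_restrict_lborel[OF g] integral_slope)
qed

lemma finite_slope_measure:
  assumes "\<And>x. 0 \<le> g x"
  shows "finite_measure (slope_measure a b g)"
  using emeasure_slope_measure[OF assms] by (intro finite_measureI) (simp add: space_restrict_space)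

lemma measure_deriv:
  assumes "\<And>x. 0 \<le> g x"
  shows "has_measure_deriv a b f (measure (slope_measure a b g))"
  unfolding has_measure_deriv_def
proof (intro conjI allI impI)
  note fin = finite_slope_measure[OF assms]
  show "integrable (lebesgue_on {a<..<b}) f"
    using weak_deriv by (simp add: has_weak_deriv_def)
  show "signed_measure (borel_on a b) (measure (slope_measure a b g))"
    by (rule signed_measure_measure[OF fin sets_slope_measure])
  fix \<phi> assume \<phi>: "test_function a b \<phi>"
  then have "\<phi> \<in> borel_measurable (borel_on a b)"
    using test_function_props(2)[OF \<phi>]
    by (auto intro!: measurable_restrict_space1 borel_measurable_continuous_onI)
  then show "(LINT x|lebesgue_on {a<..<b}. f x * deriv \<phi> x)
      = - signed_integral (borel_on a b) (measure (slope_measure a b g)) \<phi>"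
    using \<phi> weak_deriv
    by (simp add: has_weak_deriv_def integral_slope_measure[OF assms]
       signed_integral_measure[OF fin sets_slope_measure])
qed

lemma variation_slope_measure:
  assumes "\<And>x. 0 \<le> g x"
  shows "variation (borel_on a b) (measure (slope_measure a b g)) {a<..<b} = ennreal (f b - f a)"
  unfolding variation_measure[OF finite_slope_measure[OF assms] sets_slope_measure Ioo_in_sets_borel_on]
  by (rule emeasure_slope_measure[OF assms])

lemma Linf: "Linf_fun b f" "Linf_fun b g" if "a = 0"
proof -
  obtain B where B: "\<And>x. x \<in> {a..b} \<Longrightarrow> \<bar>f x\<bar> \<le> B" using f_bounded by blast
  show "Linf_fun b f"
    unfolding Linf_fun_def using B that
    by (intro conjI exI[of _ B] AE_I2) (auto intro!: borel_measurable_lebesgue_on f_measurable)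
  show "Linf_fun b g"
    unfolding Linf_fun_def using bd
    by (intro conjI exI[of _ C] AE_I2) (auto intro!: borel_measurable_lebesgue_on meas)
qed

lemma W1inf: "W1inf_deriv b f g" if "a = 0"
  unfolding W1inf_deriv_def using Linf[OF that] weak_deriv cont that
  by (auto intro: continuous_on_subset)

lemma H1: "H1_deriv b f g" if "a = 0"
proof -
  obtain B where B: "\<And>x. x \<in> {a..b} \<Longrightarrow> \<bar>f x\<bar> \<le> B" using f_bounded by blast
  have sq: "(f x)\<^sup>2 \<le> B\<^sup>2" "(g x)\<^sup>2 \<le> C\<^sup>2" if "x \<in> {0<..<b}" for x
    using B[of x] bd[of x] that \<open>a = 0\<close> power_mono[of "\<bar>f x\<bar>" B 2] power_mono[of "\<bar>g x\<bar>" C 2] by auto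
  have [measurable]: "f \<in> borel_measurable borel" "g \<in> borel_measurable borel"
    by (rule f_measurable meas)+
  have "integrable (lebesgue_on {0<..<b}) (\<lambda>x. (f x)\<^sup>2)" "integrable (lebesgue_on {0<..<b}) (\<lambda>x. (g x)\<^sup>2)"
    by (rule integrable_bounded_Ioo; use sq in \<open>auto intro!: borel_measurable_lebesgue_on\<close>)+
  then show ?thesis
    unfolding H1_deriv_def L2_fun_def using weak_deriv that
    by (auto intro!: borel_measurable_lebesgue_on)
qed

text \<open>
  The chain rule for \<open>f\<^sup>2 / 2\<close>, which is the work done by the load along a solution with \<open>z = l\<close>.
\<close>

lemma square_integral: "(LINT x|lebesgue_on {a<..<b}. f x * g x) = ((f b)\<^sup>2 - (f a)\<^sup>2) / 2"
proof -
  obtain B where B: "\<And>x. x \<in> {a..b} \<Longrightarrow> \<bar>f x\<bar> \<le> B" using f_bounded by blast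
  have "(LINT x|lebesgue_on {a<..<b}. f x * g x) = (f b)\<^sup>2 / 2 - (f a)\<^sup>2 / 2"
  proof (rule lebesgue_integral_FTC_Ioo[OF K ab, where C = "B * C"])
    show "continuous_on {a..b} (\<lambda>x. (f x)\<^sup>2 / 2)"
      by (intro continuous_intros continuous_on_subset[OF cont]) auto
    show "((\<lambda>x. (f x)\<^sup>2 / 2) has_real_derivative f x * g x) (at x)" if "x \<in> {a<..<b} - K" for x
      using that by (auto intro!: derivative_eq_intros der)
    show "(\<lambda>x. f x * g x) \<in> borel_measurable (lebesgue_on {a<..<b})"
      by (intro borel_measurable_lebesgue_on borel_measurable_times f_measurable meas)
    show "\<bar>f x * g x\<bar> \<le> B * C" if "x \<in> {a<..<b}" for x
      using B[of x] bd[of x] that by (auto simp: abs_mult intro!: mult_mono)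
  qed
  then show ?thesis by (simp add: diff_divide_distrib)
qed

end

section \<open>Monotone functions and broken lines\<close>

lemma BV_on_mono:
  assumes "mono_on {a..b} f"
  shows "BV_on a b f"
  unfolding BV_on_def
proof (intro exI allI impI)
  fix p :: "nat \<Rightarrow> real" and m
  assume p: "p ` {..m} \<subseteq> {a..b} \<and> mono_on {..m} p"
  have "\<bar>f (p (Suc i)) - f (p i)\<bar> = f (p (Suc i)) - f (p i)" if "i < m" for i
    using that p by (intro abs_of_nonneg) (auto intro!: mono_onD[OF assms] mono_onD[of "{..m}" p])
  then have "(\<Sum>i<m. \<bar>f (p (Suc i)) - f (p i)\<bar>) = f (p m) - f (p 0)"
    using sum_lessThan_telescope[of "\<lambda>i. f (p i)" m] by simp
  also have "\<dots> \<le> f b - f a"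
  proof -
    have "p m \<in> {a..b}" "p 0 \<in> {a..b}" using p by blast+
    then show ?thesis
      using mono_onD[OF assms, of "p m" b] mono_onD[OF assms, of a "p 0"] by auto
  qed
  finally show "(\<Sum>i<m. \<bar>f (p (Suc i)) - f (p i)\<bar>) \<le> f b - f a" .
qed

text \<open>
  The piecewise constant slopes include the right end \<open>q\<close> in the middle piece. When the breakpoints
  decrease to \<open>q\<close>, the slopes then converge at every point, the limiting breakpoint included.
\<close>

definition three_step :: "real \<Rightarrow> real \<Rightarrow> real \<Rightarrow> real \<Rightarrow> real \<Rightarrow> real \<Rightarrow> real" where
  "three_step p q \<alpha> \<beta> \<gamma> x = (if x \<le> p then \<alpha> else if x \<le> q then \<beta> else \<gamma>)"

text \<open>
  The primitive of \<open>three_step\<close> that vanishes at 0 (for \<open>0 \<le> p \<le> q\<close>). The minima and maxima make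
  continuity, monotonicity and continuous dependence on the parameters immediate.
\<close>

definition broken_line :: "real \<Rightarrow> real \<Rightarrow> real \<Rightarrow> real \<Rightarrow> real \<Rightarrow> real \<Rightarrow> real" where
  "broken_line p q \<alpha> \<beta> \<gamma> x =
     \<alpha> * min x p + \<beta> * (max p (min x q) - p) + \<gamma> * (max x q - q)"

lemma three_step_nonneg:
  "0 \<le> \<alpha> \<Longrightarrow> 0 \<le> \<beta> \<Longrightarrow> 0 \<le> \<gamma> \<Longrightarrow> 0 \<le> three_step p q \<alpha> \<beta> \<gamma> x"
  by (simp add: three_step_def)

lemma broken_line_cases:
  assumes "p \<le> q"
  shows "x \<le> p \<Longrightarrow> broken_line p q \<alpha> \<beta> \<gamma> x = \<alpha> * x"
    and "p \<le> x \<Longrightarrow> x \<le> q \<Longrightarrow> broken_line p q \<alpha> \<beta> \<gamma> x = \<alpha> * p + \<beta> * (x - p)"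
    and "q \<le> x \<Longrightarrow> broken_line p q \<alpha> \<beta> \<gamma> x = \<alpha> * p + \<beta> * (q - p) + \<gamma> * (x - q)"
  using assms by (simp_all add: broken_line_def min_def max_def)

lemma bounded_primitive_broken_line:
  assumes pq: "p \<le> q" and "a \<le> b"
  shows "bounded_primitive a b (broken_line p q \<alpha> \<beta> \<gamma>) (three_step p q \<alpha> \<beta> \<gamma>) {p, q}
           (\<bar>\<alpha>\<bar> + \<bar>\<beta>\<bar> + \<bar>\<gamma>\<bar>)"
proof
  let ?f = "broken_line p q \<alpha> \<beta> \<gamma>"
  show "continuous_on UNIV ?f"
    unfolding broken_line_def by (intro continuous_intros)
  show "three_step p q \<alpha> \<beta> \<gamma> \<in> borel_measurable borel"
    unfolding three_step_def by measurable
  show "(?f has_real_derivative three_step p q \<alpha> \<beta> \<gamma> x) (at x)" if x: "x \<notin> {p, q}" for x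
  proof -
    consider "x < p" | "p < x" "x < q" | "q < x" using x pq by fastforce
    then show ?thesis
    proof cases
      case 1
      have "((\<lambda>x. \<alpha> * x) has_real_derivative \<alpha>) (at x)"
        by (auto intro!: derivative_eq_intros)
      then have "(?f has_real_derivative \<alpha>) (at x)"
        by (rule has_field_derivative_transform_within_open[of _ _ _ "{..<p}"])
          (use 1 pq in \<open>auto simp: broken_line_cases\<close>)
      then show ?thesis using 1 by (simp add: three_step_def)
    next
      case 2
      have "((\<lambda>x. \<alpha> * p + \<beta> * (x - p)) has_real_derivative \<beta>) (at x)"
        by (auto intro!: derivative_eq_intros)
      then have "(?f has_real_derivative \<beta>) (at x)"
        by (rule has_field_derivative_transform_within_open[of _ _ _ "{p<..<q}"])
          (use 2 pq in \<open>auto simp: broken_line_cases\<close>)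
      then show ?thesis using 2 by (simp add: three_step_def)
    next
      case 3
      have "((\<lambda>x. \<alpha> * p + \<beta> * (q - p) + \<gamma> * (x - q)) has_real_derivative \<gamma>) (at x)"
        by (auto intro!: derivative_eq_intros)
      then have "(?f has_real_derivative \<gamma>) (at x)"
        by (rule has_field_derivative_transform_within_open[of _ _ _ "{q<..}"])
          (use 3 pq in \<open>auto simp: broken_line_cases\<close>)
      then show ?thesis using 3 pq by (simp add: three_step_def)
    qed
  qed
  show "\<bar>three_step p q \<alpha> \<beta> \<gamma> x\<bar> \<le> \<bar>\<alpha>\<bar> + \<bar>\<beta>\<bar> + \<bar>\<gamma>\<bar>" for x
    by (simp add: three_step_def)
qed (use assms in auto)

lemma broken_line_mono:
  assumes "0 \<le> \<alpha>" "0 \<le> \<beta>" "0 \<le> \<gamma>" "x \<le> y"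
  shows "broken_line p q \<alpha> \<beta> \<gamma> x \<le> broken_line p q \<alpha> \<beta> \<gamma> y"
  unfolding broken_line_def
  by (intro add_mono mult_left_mono assms diff_mono max.mono min.mono order.refl)

lemma BV_on_broken_line:
  assumes "0 \<le> \<alpha>" "0 \<le> \<beta>" "0 \<le> \<gamma>"
  shows "BV_on a b (broken_line p q \<alpha> \<beta> \<gamma>)"
  using assms by (intro BV_on_mono mono_onI broken_line_mono)

text \<open>
  Subtracting the smallest slope leaves a broken line with nonnegative slopes, so the function grows
  at least linearly.
\<close>

lemma broken_line_strict_mono:
  assumes "p \<le> q" "0 < \<alpha>" "0 < \<beta>" "0 < \<gamma>" "x < y"
  shows "broken_line p q \<alpha> \<beta> \<gamma> x < broken_line p q \<alpha> \<beta> \<gamma> y"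
proof -
  define m where "m = min \<alpha> (min \<beta> \<gamma>)"
  have split: "broken_line p q \<alpha> \<beta> \<gamma> u = broken_line p q (\<alpha> - m) (\<beta> - m) (\<gamma> - m) u + m * u" for u
  proof -
    have "min u p + (max p (min u q) - p) + (max u q - q) = u"
      using assms(1) by (simp add: min_def max_def)
    then have "m * u = m * (min u p + (max p (min u q) - p) + (max u q - q))" by simp
    then show ?thesis by (simp add: broken_line_def algebra_simps)
  qed
  have "broken_line p q (\<alpha> - m) (\<beta> - m) (\<gamma> - m) x \<le> broken_line p q (\<alpha> - m) (\<beta> - m) (\<gamma> - m) y"
    by (rule broken_line_mono) (use assms m_def in auto)
  moreover have "m * x < m * y" using assms by (simp add: m_def)
  ultimately show ?thesis unfolding split by linarith
qed

lemma broken_line_bound: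
  assumes "0 \<le> p" "p \<le> q" "0 \<le> x" "x \<le> S"
  shows "\<bar>broken_line p q \<alpha> \<beta> \<gamma> x\<bar> \<le> (\<bar>\<alpha>\<bar> + \<bar>\<beta>\<bar> + \<bar>\<gamma>\<bar>) * S"
proof -
  have le: "\<bar>min x p\<bar> \<le> S" "\<bar>max p (min x q) - p\<bar> \<le> S" "\<bar>max x q - q\<bar> \<le> S"
    using assms by auto
  have "\<bar>broken_line p q \<alpha> \<beta> \<gamma> x\<bar>
      \<le> \<bar>\<alpha> * min x p\<bar> + \<bar>\<beta> * (max p (min x q) - p)\<bar> + \<bar>\<gamma> * (max x q - q)\<bar>"
    unfolding broken_line_def by (rule order.trans[OF abs_triangle_ineq add_right_mono[OF abs_triangle_ineq]])
  also have "\<dots> \<le> \<bar>\<alpha>\<bar> * S + \<bar>\<beta>\<bar> * S + \<bar>\<gamma>\<bar> * S"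
    unfolding abs_mult by (intro add_mono mult_left_mono le abs_ge_zero)
  finally show ?thesis by (simp add: distrib_right)
qed

section \<open>Broken lines with converging parameters\<close>

text \<open>
  The three modes are used for functions and slopes alike; each is dominated convergence, with a
  multiple of \<open>\<bar>h\<bar>\<close> or a constant as majorant.
\<close>

lemma bounded_pointwise_conv:
  fixes f :: "real \<Rightarrow> real"
  assumes [measurable]: "\<And>n. fs n \<in> borel_measurable borel" "f \<in> borel_measurable borel"
    and bd: "\<And>n x. x \<in> {0<..<S} \<Longrightarrow> \<bar>fs n x\<bar> \<le> C"
    and lim: "\<And>x. x \<in> {0<..<S} \<Longrightarrow> (\<lambda>n. fs n x) \<longlonglongrightarrow> f x"
  shows bounded_pointwise_imp_weak_star: "Linf_weak_star_conv S fs f"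
    and bounded_pointwise_imp_L1: "L1_conv 0 S fs f"
    and bounded_pointwise_imp_L2: "(\<lambda>n. LINT x|lebesgue_on {0<..<S}. (fs n x - f x)\<^sup>2) \<longlonglongrightarrow> 0"
proof -
  note [intro!] = borel_measurable_lebesgue_on
  have fbd: "\<bar>f x\<bar> \<le> C" if "x \<in> {0<..<S}" for x
    using LIMSEQ_le_const2[OF tendsto_rabs[OF lim[OF that]]] bd[OF that] by blast
  have dif: "\<bar>fs n x - f x\<bar> \<le> 2 * C" if "x \<in> {0<..<S}" for n x
    using bd[OF that, of n] fbd[OF that] by linarith
  have const: "integrable (lebesgue_on {0<..<S}) (\<lambda>x. c)" for c :: real
    by (rule integrable_bounded_Ioo[of _ _ _ "\<bar>c\<bar>"]) auto
  show "Linf_weak_star_conv S fs f"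
    unfolding Linf_weak_star_conv_def
  proof (intro allI impI)
    fix h :: "real \<Rightarrow> real" assume h: "integrable (lebesgue_on {0<..<S}) h"
    have hm: "h \<in> borel_measurable (lebesgue_on {0<..<S})" using h by simp
    show "(\<lambda>n. LINT x|lebesgue_on {0<..<S}. fs n x * h x) \<longlonglongrightarrow> (LINT x|lebesgue_on {0<..<S}. f x * h x)"
    proof (rule integral_dominated_convergence[where w = "\<lambda>x. C * \<bar>h x\<bar>"])
      show "integrable (lebesgue_on {0<..<S}) (\<lambda>x. C * \<bar>h x\<bar>)" using h by simp
      show "AE x in lebesgue_on {0<..<S}. (\<lambda>n. fs n x * h x) \<longlonglongrightarrow> f x * h x"
        by (rule AE_I2) (auto intro!: tendsto_intros lim)
      show "AE x in lebesgue_on {0<..<S}. norm (fs n x * h x) \<le> C * \<bar>h x\<bar>" for n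
        by (rule AE_I2) (auto simp: abs_mult intro!: mult_right_mono bd)
    qed (intro borel_measurable_times hm borel_measurable_lebesgue_on assms(1,2))+
  qed
  have fi: "integrable (lebesgue_on {0<..<S}) f"
    by (rule integrable_bounded_Ioo[OF _ fbd]) auto
  have fsi: "integrable (lebesgue_on {0<..<S}) (fs n)" for n
    by (rule integrable_bounded_Ioo[OF _ bd]) auto
  have "(\<lambda>n. LINT x|lebesgue_on {0<..<S}. \<bar>fs n x - f x\<bar>) \<longlonglongrightarrow> (LINT x|lebesgue_on {0<..<S}. 0)"
  proof (rule integral_dominated_convergence[where w = "\<lambda>x. 2 * C"])
    show "AE x in lebesgue_on {0<..<S}. (\<lambda>n. \<bar>fs n x - f x\<bar>) \<longlonglongrightarrow> 0"
    proof (rule AE_I2)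
      fix x assume "x \<in> space (lebesgue_on {0<..<S})"
      then have "(\<lambda>n. \<bar>fs n x - f x\<bar>) \<longlonglongrightarrow> \<bar>f x - f x\<bar>"
        by (intro tendsto_intros lim) auto
      then show "(\<lambda>n. \<bar>fs n x - f x\<bar>) \<longlonglongrightarrow> 0" by simp
    qed
    show "AE x in lebesgue_on {0<..<S}. norm \<bar>fs n x - f x\<bar> \<le> 2 * C" for n
      by (rule AE_I2) (auto intro: dif)
  qed (auto intro: const)
  then show "L1_conv 0 S fs f" unfolding L1_conv_def using fi fsi by simp
  have "(\<lambda>n. LINT x|lebesgue_on {0<..<S}. (fs n x - f x)\<^sup>2) \<longlonglongrightarrow> (LINT x|lebesgue_on {0<..<S}. 0)"
  proof (rule integral_dominated_convergence[where w = "\<lambda>x. (2 * C)\<^sup>2"])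
    show "AE x in lebesgue_on {0<..<S}. (\<lambda>n. (fs n x - f x)\<^sup>2) \<longlonglongrightarrow> 0"
    proof (rule AE_I2)
      fix x assume "x \<in> space (lebesgue_on {0<..<S})"
      then have "(\<lambda>n. (fs n x - f x)\<^sup>2) \<longlonglongrightarrow> (f x - f x)\<^sup>2"
        by (intro tendsto_intros lim) auto
      then show "(\<lambda>n. (fs n x - f x)\<^sup>2) \<longlonglongrightarrow> 0" by simp
    qed
    show "AE x in lebesgue_on {0<..<S}. norm ((fs n x - f x)\<^sup>2) \<le> (2 * C)\<^sup>2" for n
    proof (rule AE_I2)
      fix x assume "x \<in> space (lebesgue_on {0<..<S})"
      then have "\<bar>fs n x - f x\<bar>\<^sup>2 \<le> (2 * C)\<^sup>2"
        by (intro power_mono dif) auto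
      then show "norm ((fs n x - f x)\<^sup>2) \<le> (2 * C)\<^sup>2" by simp
    qed
  qed (auto intro: const)
  then show "(\<lambda>n. LINT x|lebesgue_on {0<..<S}. (fs n x - f x)\<^sup>2) \<longlonglongrightarrow> 0" by simp
qed

text \<open>
  Only the right breakpoint and the middle slope vary. The breakpoints must approach their limit from
  the right so that the slopes converge pointwise.
\<close>

locale broken_line_sequence =
  fixes S p \<alpha> \<gamma> :: real and qs \<beta>s :: "nat \<Rightarrow> real" and q \<beta> B :: real
  assumes S: "0 \<le> S" and p: "0 \<le> p" and pq: "p \<le> q" and q_qs: "\<And>n. q \<le> qs n"
    and qs: "qs \<longlonglongrightarrow> q" and \<beta>s: "\<beta>s \<longlonglongrightarrow> \<beta>" and bd: "\<And>n. \<bar>\<beta>s n\<bar> \<le> B"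
begin

abbreviation "fs n \<equiv> broken_line p (qs n) \<alpha> (\<beta>s n) \<gamma>"
abbreviation "f \<equiv> broken_line p q \<alpha> \<beta> \<gamma>"
abbreviation "gs n \<equiv> three_step p (qs n) \<alpha> (\<beta>s n) \<gamma>"
abbreviation "g \<equiv> three_step p q \<alpha> \<beta> \<gamma>"

lemma prims:
  "bounded_primitive 0 S (fs n) (gs n) {p, qs n} (\<bar>\<alpha>\<bar> + \<bar>\<beta>s n\<bar> + \<bar>\<gamma>\<bar>)"
  "bounded_primitive 0 S f g {p, q} (\<bar>\<alpha>\<bar> + \<bar>\<beta>\<bar> + \<bar>\<gamma>\<bar>)"
  using pq q_qs S by (auto intro!: bounded_primitive_broken_line intro: order.trans)

lemma f_conv: "(\<lambda>n. fs n x) \<longlonglongrightarrow> f x"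
  unfolding broken_line_def by (intro tendsto_intros qs \<beta>s)

lemma g_conv: "(\<lambda>n. gs n x) \<longlonglongrightarrow> g x"
proof (cases "x \<le> q")
  case True
  then have "gs n x = (if x \<le> p then \<alpha> else \<beta>s n)" for n
    using q_qs[of n] by (simp add: three_step_def)
  then show ?thesis using True \<beta>s by (simp add: three_step_def)
next
  case False
  then have "eventually (\<lambda>n. qs n < x) sequentially"
    using qs by (auto intro: order_tendstoD)
  then have "eventually (\<lambda>n. g x = gs n x) sequentially"
    by eventually_elim (use False pq in \<open>auto simp: three_step_def\<close>)
  then show ?thesis by (rule tendsto_eventually[OF eventually_mono]) simp
qed

lemma f_bd: "\<bar>fs n x\<bar> \<le> (\<bar>\<alpha>\<bar> + B + \<bar>\<gamma>\<bar>) * S" if "x \<in> {0<..<S}"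
proof -
  have "\<bar>fs n x\<bar> \<le> (\<bar>\<alpha>\<bar> + \<bar>\<beta>s n\<bar> + \<bar>\<gamma>\<bar>) * S"
    using that p pq q_qs[of n] by (intro broken_line_bound) auto
  also have "\<dots> \<le> (\<bar>\<alpha>\<bar> + B + \<bar>\<gamma>\<bar>) * S"
    using bd[of n] S by (intro mult_right_mono) auto
  finally show ?thesis .
qed

lemma g_bd: "\<bar>gs n x\<bar> \<le> \<bar>\<alpha>\<bar> + B + \<bar>\<gamma>\<bar>"
  using bounded_primitive.bd[OF prims(1), of n x] bd[of n] by linarith

lemmas f_bounded_pointwise = bounded_pointwise_conv[of fs f S, OF
    bounded_primitive.f_measurable[OF prims(1)] bounded_primitive.f_measurable[OF prims(2)] f_bd f_conv]
lemmas g_bounded_pointwise = bounded_pointwise_conv[of gs g S, OF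
    bounded_primitive.meas[OF prims(1)] bounded_primitive.meas[OF prims(2)] g_bd g_conv]

lemma H1_conv: "H1_conv S fs f"
  unfolding H1_conv_def
  using bounded_primitive.H1[OF prims(1) refl] bounded_primitive.H1[OF prims(2) refl]
    tendsto_add[OF f_bounded_pointwise(3) g_bounded_pointwise(3)]
  by (intro exI[of _ gs] exI[of _ g]) simp

lemma W1inf_weak_star_conv: "W1inf_weak_star_conv S fs f"
  unfolding W1inf_weak_star_conv_def
  using bounded_primitive.W1inf[OF prims(1) refl] bounded_primitive.W1inf[OF prims(2) refl]
    f_bounded_pointwise(1) g_bounded_pointwise(1)
  by (intro exI[of _ gs] exI[of _ g]) simp

text \<open>
  The derivative measures have the slopes as densities, and these converge weakly* even in
  \<open>L\<^sup>\<infinity>\<close>; the total variation is the increment of the function, which converges too.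
\<close>

lemma intermediate_conv:
  assumes "0 \<le> \<alpha>" "\<And>n. 0 \<le> \<beta>s n" "0 \<le> \<beta>" "0 \<le> \<gamma>"
  shows "intermediate_conv S fs f"
proof -
  have gs: "0 \<le> gs n x" and g: "0 \<le> g x" for n x
    using assms by (auto intro: three_step_nonneg)
  note Ns = bounded_primitive.measure_deriv[OF prims(1) gs]
    bounded_primitive.variation_slope_measure[OF prims(1) gs]
    signed_integral_measure[OF bounded_primitive.finite_slope_measure[OF prims(1) gs]
      bounded_primitive.sets_slope_measure[OF prims(1)]]
    bounded_primitive.integral_slope_measure[OF prims(1) gs]
  note Ms = bounded_primitive.measure_deriv[OF prims(2) g]
    bounded_primitive.variation_slope_measure[OF prims(2) g]
    signed_integral_measure[OF bounded_primitive.finite_slope_measure[OF prims(2) g]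
      bounded_primitive.sets_slope_measure[OF prims(2)]]
    bounded_primitive.integral_slope_measure[OF prims(2) g]
  have "measures_weak_star_conv 0 S (\<lambda>n. measure (slope_measure 0 S (gs n)))
      (measure (slope_measure 0 S g))"
    unfolding measures_weak_star_conv_def
  proof (intro allI impI)
    fix \<phi> assume "C0_on 0 S \<phi>"
    then have m: "\<phi> \<in> borel_measurable (borel_on 0 S)" and "integrable (lebesgue_on {0<..<S}) \<phi>"
      by (rule C0_on_measurable, rule C0_on_integrable)
    then show "(\<lambda>n. signed_integral (borel_on 0 S) (measure (slope_measure 0 S (gs n))) \<phi>)
        \<longlonglongrightarrow> signed_integral (borel_on 0 S) (measure (slope_measure 0 S g)) \<phi>"
      using g_bounded_pointwise(1) unfolding Linf_weak_star_conv_def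
      by (simp only: Ns(3) Ns(4)[OF m] Ms(3) Ms(4)[OF m])
  qed
  moreover have "(\<lambda>n. variation (borel_on 0 S) (measure (slope_measure 0 S (gs n))) {0<..<S})
      \<longlonglongrightarrow> variation (borel_on 0 S) (measure (slope_measure 0 S g)) {0<..<S}"
    unfolding Ns(2) Ms(2) by (intro tendsto_ennrealI tendsto_intros f_conv)
  ultimately show ?thesis
    unfolding intermediate_conv_def using Ns(1) Ms(1) f_bounded_pointwise(2) assms
    by (intro conjI allI BV_on_broken_line exI[of _ "\<lambda>n. measure (slope_measure 0 S (gs n))"]
        exI[of _ "measure (slope_measure 0 S g)"])
qed

end

section \<open>Ramps steepening to a jump\<close>

abbreviation jump_measure :: "real \<Rightarrow> real \<Rightarrow> real \<Rightarrow> real measure" where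
  "jump_measure b c h \<equiv> density (return (borel_on 0 b) c) (\<lambda>_. ennreal h)"

lemma sets_jump_measure: "sets (jump_measure b c h) = sets (borel_on 0 b)"
  by (simp only: sets_density sets_return)

lemma emeasure_jump_measure:
  assumes "0 < c" "c < b"
  shows "emeasure (jump_measure b c h) {0<..<b} = ennreal h"
  using assms Ioo_in_sets_borel_on by (simp add: emeasure_density_const)

lemma finite_jump_measure:
  assumes "0 < c" "c < b"
  shows "finite_measure (jump_measure b c h)"
  using emeasure_jump_measure[OF assms] by (intro finite_measureI) (simp add: space_restrict_space)

lemma integral_jump_measure:
  assumes "0 < c" "c < b" "0 \<le> h" and \<phi>: "\<phi> \<in> borel_measurable (borel_on 0 b)"
  shows "integral\<^sup>L (jump_measure b c h) \<phi> = h * \<phi> c"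
proof -
  have "integral\<^sup>L (jump_measure b c h) \<phi> = (\<integral>x. h *\<^sub>R \<phi> x \<partial>return (borel_on 0 b) c)"
    using \<phi> \<open>0 \<le> h\<close> by (intro integral_density) simp_all
  also have "\<dots> = h *\<^sub>R \<phi> c"
    using assms by (intro integral_return) (simp_all add: space_restrict_space)
  finally show ?thesis by simp
qed

text \<open>
  The step function times the derivative of a test function is the derivative of the continuous
  function \<open>h * (\<phi> (max x c) - \<phi> c)\<close>, so the fundamental theorem yields the point mass at \<open>c\<close>.
\<close>

lemma measure_deriv_jump:
  assumes c: "0 < c" "c < b" and h: "0 \<le> h"
  shows "has_measure_deriv 0 b (\<lambda>x. if x \<le> c then 0 else h) (measure (jump_measure b c h))"
  unfolding has_measure_deriv_def
proof (intro conjI allI impI)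
  note fin = finite_jump_measure[OF c, of h]
  let ?f = "\<lambda>x. if x \<le> c then 0 else h"
  have f: "?f \<in> borel_measurable borel" by measurable
  show "integrable (lebesgue_on {0<..<b}) ?f"
    by (rule integrable_bounded_Ioo[of _ _ _ h]) (use h in \<open>auto intro!: borel_measurable_lebesgue_on\<close>)
  show "signed_measure (borel_on 0 b) (measure (jump_measure b c h))"
    by (rule signed_measure_measure[OF fin sets_jump_measure])
  fix \<phi> assume "test_function 0 b \<phi>"
  note \<phi> = test_function_props[OF this]
  obtain Q where Q: "\<And>x. x \<in> {0..b} \<Longrightarrow> \<bar>deriv \<phi> x\<bar> \<le> Q"
    using continuous_bounded_Icc[OF \<phi>(3)] by blast
  have "(LINT x|lebesgue_on {0<..<b}. ?f x * deriv \<phi> x)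
      = h * (\<phi> (max b c) - \<phi> c) - h * (\<phi> (max 0 c) - \<phi> c)"
  proof (rule lebesgue_integral_FTC_Ioo[of "{c}", where C = "h * Q"])
    show "continuous_on {0..b} (\<lambda>x. h * (\<phi> (max x c) - \<phi> c))"
      by (intro continuous_intros continuous_on_compose2[OF \<phi>(2)]) auto
    show "((\<lambda>x. h * (\<phi> (max x c) - \<phi> c)) has_real_derivative ?f x * deriv \<phi> x) (at x)"
      if x: "x \<in> {0<..<b} - {c}" for x
    proof (cases "x < c")
      case True
      have "((\<lambda>x. h * (\<phi> (max x c) - \<phi> c)) has_real_derivative 0) (at x)"
        by (rule has_field_derivative_transform_within_open[of "\<lambda>_. 0" _ _ "{..<c}"])
          (use True in auto)
      then show ?thesis using True by simp
    next
      case False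
      have "((\<lambda>x. h * (\<phi> x - \<phi> c)) has_real_derivative h * deriv \<phi> x) (at x)"
        by (auto intro!: derivative_eq_intros \<phi>(1))
      then have "((\<lambda>x. h * (\<phi> (max x c) - \<phi> c)) has_real_derivative h * deriv \<phi> x) (at x)"
        by (rule has_field_derivative_transform_within_open[of _ _ _ "{c<..}"])
          (use False x in \<open>auto simp: max_def\<close>)
      then show ?thesis using False x by simp
    qed
    have "deriv \<phi> \<in> borel_measurable borel"
      using \<phi>(3) by (rule borel_measurable_continuous_onI)
    then show "(\<lambda>x. ?f x * deriv \<phi> x) \<in> borel_measurable (lebesgue_on {0<..<b})"
      by (intro borel_measurable_lebesgue_on borel_measurable_times f)
    show "\<bar>?f x * deriv \<phi> x\<bar> \<le> h * Q" if "x \<in> {0<..<b}" for x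
    proof -
      have "\<bar>?f x\<bar> * \<bar>deriv \<phi> x\<bar> \<le> h * Q"
        using that h Q[of x] by (intro mult_mono) auto
      then show ?thesis by (simp only: abs_mult)
    qed
  qed (use c in auto)
  also have "\<dots> = - (h * \<phi> c)"
    using c \<phi>(4)[of b] by (simp add: max_def)
  also have "h * \<phi> c = signed_integral (borel_on 0 b) (measure (jump_measure b c h)) \<phi>"
    unfolding signed_integral_measure[OF fin sets_jump_measure]
    by (rule integral_jump_measure[OF c h, symmetric])
      (rule measurable_restrict_space1, rule borel_measurable_continuous_onI[OF \<phi>(2)])
  finally show "(LINT x|lebesgue_on {0<..<b}. ?f x * deriv \<phi> x)
      = - signed_integral (borel_on 0 b) (measure (jump_measure b c h)) \<phi>" .
qed

locale steepening_ramp =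
  fixes b c h :: real and qs :: "nat \<Rightarrow> real"
  assumes c: "0 < c" "c < b" and h: "0 \<le> h" and qs: "\<And>n. c < qs n" "\<And>n. qs n \<le> b" "qs \<longlonglongrightarrow> c"
begin

abbreviation "ramp n \<equiv> broken_line c (qs n) 0 (h / (qs n - c)) 0"
abbreviation "steps n \<equiv> three_step c (qs n) 0 (h / (qs n - c)) 0"
abbreviation "jump \<equiv> \<lambda>x. if x \<le> c then 0 else h"

lemma slope_nonneg: "0 \<le> h / (qs n - c)"
  using h qs(1)[of n] by simp

lemma prim: "bounded_primitive 0 b (ramp n) (steps n) {c, qs n} (\<bar>0\<bar> + \<bar>h / (qs n - c)\<bar> + \<bar>0\<bar>)"
  by (rule bounded_primitive_broken_line) (use c qs(1)[of n] in auto)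

lemma steps_nonneg: "0 \<le> steps n x"
  by (intro three_step_nonneg slope_nonneg) simp_all

lemma ramp_cases: "x \<le> c \<Longrightarrow> ramp n x = 0" "qs n \<le> x \<Longrightarrow> ramp n x = h"
  using qs(1)[of n] by (simp_all add: broken_line_cases)

lemma ramp_L1_conv: "L1_conv 0 b ramp jump"
proof (rule bounded_pointwise_imp_L1[where C = h])
  show "ramp n \<in> borel_measurable borel" for n by (rule bounded_primitive.f_measurable[OF prim])
  show "jump \<in> borel_measurable borel" by measurable
  show "\<bar>ramp n x\<bar> \<le> h" if "x \<in> {0<..<b}" for n x
  proof -
    have "ramp n 0 \<le> ramp n x" "ramp n x \<le> ramp n b"
      using that slope_nonneg by (auto intro!: broken_line_mono)
    then show ?thesis using ramp_cases(1)[of 0 n] ramp_cases(2)[of n b] c qs(2)[of n] by simp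
  qed
  show "(\<lambda>n. ramp n x) \<longlonglongrightarrow> jump x" for x
  proof (cases "x \<le> c")
    case True
    then show ?thesis by (simp add: ramp_cases)
  next
    case False
    then have "eventually (\<lambda>n. qs n < x) sequentially"
      using qs(3) by (auto intro: order_tendstoD)
    then have "eventually (\<lambda>n. ramp n x = jump x) sequentially"
      by eventually_elim (use False ramp_cases(2) in simp)
    then show ?thesis by (rule tendsto_eventually)
  qed
qed

text \<open>
  The slopes are nonnegative with constant integral \<open>h\<close> and concentrate at \<open>c\<close>: they form an
  approximate identity, so continuity of \<open>\<phi>\<close> at \<open>c\<close> is all that matters.
\<close>

lemma steps_approx_dirac:
  assumes \<phi>: "C0_on 0 b \<phi>"
  shows "(\<lambda>n. LINT x|lebesgue_on {0<..<b}. steps n x * \<phi> x) \<longlonglongrightarrow> h * \<phi> c"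
proof (rule LIMSEQ_I)
  fix e :: real assume e: "0 < e"
  \<comment> \<open>The \<open>+ 1\<close> covers the degenerate height \<open>h = 0\<close> and makes the final estimate strict.\<close>
  define d where "d = e / (h + 1)"
  have d: "0 < d" using e h by (simp add: d_def)
  have "continuous_on {0<..<b} \<phi>" using \<phi> by (simp add: C0_on_def)
  then obtain \<delta> where \<delta>: "0 < \<delta>" "\<And>x. x \<in> {0<..<b} \<Longrightarrow> dist x c < \<delta> \<Longrightarrow> dist (\<phi> x) (\<phi> c) < d"
    using c d unfolding continuous_on_iff by (metis greaterThanLessThan_iff)
  obtain N where N: "\<And>n. n \<ge> N \<Longrightarrow> qs n < c + \<delta>"
    using order_tendstoD(2)[OF qs(3), of "c + \<delta>"] \<delta>(1) by (auto simp: eventually_sequentially)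
  obtain C where C: "\<And>x. x \<in> {0<..<b} \<Longrightarrow> \<bar>\<phi> x\<bar> \<le> C" using C0_on_bounded[OF \<phi>] by blast
  have \<phi>m: "\<phi> \<in> borel_measurable (lebesgue_on {0<..<b})"
    using borel_on_imp_lebesgue_on[OF C0_on_measurable[OF \<phi>]] .
  have "norm ((LINT x|lebesgue_on {0<..<b}. steps n x * \<phi> x) - h * \<phi> c) < e" if "n \<ge> N" for n
  proof -
    have steps: "integrable (lebesgue_on {0<..<b}) (steps n)"
      using bounded_primitive.weak_deriv[OF prim[of n]] by (simp add: has_weak_deriv_def)
    have tot: "(LINT x|lebesgue_on {0<..<b}. steps n x) = h"
      using bounded_primitive.integral_slope[OF prim[of n]] ramp_cases(1)[of 0 n] ramp_cases(2)[of n b] c qs(2)[of n]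
      by simp
    have int: "integrable (lebesgue_on {0<..<b}) (\<lambda>x. steps n x * \<phi> x)"
    proof (rule integrable_bounded_Ioo)
      show "(\<lambda>x. steps n x * \<phi> x) \<in> borel_measurable (lebesgue_on {0<..<b})"
        using steps \<phi>m by (intro borel_measurable_times) auto
      show "\<bar>steps n x * \<phi> x\<bar> \<le> \<bar>h / (qs n - c)\<bar> * C" if "x \<in> {0<..<b}" for x
        unfolding abs_mult
        using bounded_primitive.bd[OF prim, of n x] C[OF that] by (intro mult_mono) auto
    qed
    have "(LINT x|lebesgue_on {0<..<b}. steps n x * \<phi> x) - h * \<phi> c
        = (LINT x|lebesgue_on {0<..<b}. steps n x * \<phi> x) - (LINT x|lebesgue_on {0<..<b}. steps n x * \<phi> c)"
      by (simp add: tot)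
    also have "\<dots> = (LINT x|lebesgue_on {0<..<b}. steps n x * \<phi> x - steps n x * \<phi> c)"
      using int steps by (intro Bochner_Integration.integral_diff[symmetric]) auto
    finally have eq: "(LINT x|lebesgue_on {0<..<b}. steps n x * \<phi> x) - h * \<phi> c
        = (LINT x|lebesgue_on {0<..<b}. steps n x * \<phi> x - steps n x * \<phi> c)" .
    have "norm (LINT x|lebesgue_on {0<..<b}. steps n x * \<phi> x - steps n x * \<phi> c)
        \<le> (LINT x|lebesgue_on {0<..<b}. norm (steps n x * \<phi> x - steps n x * \<phi> c))"
      by (rule integral_norm_bound)
    also have "\<dots> \<le> (LINT x|lebesgue_on {0<..<b}. steps n x * d)"
    proof (rule integral_mono)
      show "norm (steps n x * \<phi> x - steps n x * \<phi> c) \<le> steps n x * d"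
        if "x \<in> space (lebesgue_on {0<..<b})" for x
      proof (cases "c < x \<and> x \<le> qs n")
        case True
        then have "\<bar>\<phi> x - \<phi> c\<bar> < d"
          using \<delta>(2)[of x] N[OF \<open>n \<ge> N\<close>] that by (auto simp: dist_real_def)
        then have "\<bar>steps n x\<bar> * \<bar>\<phi> x - \<phi> c\<bar> \<le> steps n x * d"
          using steps_nonneg[of n x] by (simp add: mult_left_mono)
        then show ?thesis by (simp add: abs_mult[symmetric] right_diff_distrib)
      next
        case False
        then have "steps n x = 0" by (auto simp: three_step_def)
        then show ?thesis by simp
      qed
    qed (use int steps in auto)
    also have "\<dots> = h * d" by (simp add: tot)
    also have "\<dots> < e" using e h by (simp add: d_def field_simps)
    finally show ?thesis unfolding eq .
  qed
  then show "\<exists>N. \<forall>n\<ge>N. norm ((LINT x|lebesgue_on {0<..<b}. steps n x * \<phi> x) - h * \<phi> c) < e"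
    by blast
qed

text \<open>
  A steepening ramp is monotone of height \<open>h\<close>, so no variation is lost in the limit; this is why
  intermediate convergence holds although the limit jumps.
\<close>

lemma ramp_intermediate_conv: "intermediate_conv b ramp jump"
proof -
  note Ns = bounded_primitive.measure_deriv[OF prim steps_nonneg]
    bounded_primitive.variation_slope_measure[OF prim steps_nonneg]
    signed_integral_measure[OF bounded_primitive.finite_slope_measure[OF prim steps_nonneg]
      bounded_primitive.sets_slope_measure[OF prim]]
    bounded_primitive.integral_slope_measure[OF prim steps_nonneg]
  note Js = variation_measure[OF finite_jump_measure[OF c, of h] sets_jump_measure Ioo_in_sets_borel_on]
    signed_integral_measure[OF finite_jump_measure[OF c, of h] sets_jump_measure]
  have "measures_weak_star_conv 0 b (\<lambda>n. measure (slope_measure 0 b (steps n))) (measure (jump_measure b c h))"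
    unfolding measures_weak_star_conv_def
  proof (intro allI impI)
    fix \<phi> assume \<phi>: "C0_on 0 b \<phi>"
    note m = C0_on_measurable[OF \<phi>]
    show "(\<lambda>n. signed_integral (borel_on 0 b) (measure (slope_measure 0 b (steps n))) \<phi>)
        \<longlonglongrightarrow> signed_integral (borel_on 0 b) (measure (jump_measure b c h)) \<phi>"
      using steps_approx_dirac[OF \<phi>] by (simp only: Ns(3) Ns(4)[OF m] Js(2) integral_jump_measure[OF c h m])
  qed
  moreover have "(\<lambda>n. variation (borel_on 0 b) (measure (slope_measure 0 b (steps n))) {0<..<b})
      \<longlonglongrightarrow> variation (borel_on 0 b) (measure (jump_measure b c h)) {0<..<b}"
  proof -
    have "ramp n b - ramp n 0 = h" for n
      using ramp_cases(1)[of 0 n] ramp_cases(2)[of n b] c qs(2)[of n] by simp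
    then show ?thesis unfolding Ns(2) Js(1) emeasure_jump_measure[OF c] by simp
  qed
  moreover have "BV_on 0 b (ramp n)" for n by (intro BV_on_broken_line slope_nonneg) simp_all
  moreover have "BV_on 0 b jump" using h by (intro BV_on_mono mono_onI) auto
  ultimately show ?thesis
    unfolding intermediate_conv_def
    using Ns(1) measure_deriv_jump[OF c h] ramp_L1_conv
    by (intro conjI allI exI[of _ "\<lambda>n. measure (slope_measure 0 b (steps n))"]
        exI[of _ "measure (jump_measure b c h)"])
qed

end

section \<open>The solutions for the continuous loads\<close>

lemma interval_integral_Ioo:
  assumes "s \<le> t"
  shows "interval_lebesgue_integral lebesgue (ereal s) (ereal t) f = (LINT x|lebesgue_on {s<..<t}. f x)"
  using assms
  by (simp add: interval_lebesgue_integral_def set_lebesgue_integral_def integral_restrict_space)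

lemma interval_integral_swap:
  assumes "s < t"
  shows "interval_lebesgue_integral M (ereal t) (ereal s) f
    = - interval_lebesgue_integral M (ereal s) (ereal t) f"
  using assms by (simp add: interval_lebesgue_integral_def)

lemma subdifferential_dissip: "subdifferential dissip 0 = {-1..1}"
proof (rule set_eqI)
  fix \<xi> :: real
  have "(\<forall>v. \<xi> * v \<le> \<bar>v\<bar>) \<longleftrightarrow> \<bar>\<xi>\<bar> \<le> 1"
  proof
    assume "\<forall>v. \<xi> * v \<le> \<bar>v\<bar>"
    from this[rule_format, of 1] this[rule_format, of "-1"] show "\<bar>\<xi>\<bar> \<le> 1" by simp
  next
    assume "\<bar>\<xi>\<bar> \<le> 1"
    then have "\<bar>\<xi>\<bar> * \<bar>v\<bar> \<le> 1 * \<bar>v\<bar>" for v by (intro mult_right_mono) auto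
    then show "\<forall>v. \<xi> * v \<le> \<bar>v\<bar>" by (metis abs_ge_self abs_mult mult_1 order.trans)
  qed
  then show "\<xi> \<in> subdifferential dissip 0 \<longleftrightarrow> \<xi> \<in> {-1..1}"
    by (auto simp: subdifferential_def dissip_def)
qed

text \<open>
  Along \<open>z = l\<close> the driving force \<open>-(z - 1 - l)\<close> is constantly 1, the right end of the elastic range
  \<open>[-1, 1]\<close>: the state may slide, and does so without viscous dissipation.
\<close>

lemma force_dist_balanced:
  assumes "l s = z"
  shows "force_dist energy dissip l s z = 0"
proof -
  have "((\<lambda>y. energy y - l s * y) has_real_derivative z - 1 - l s) (at z)"
    unfolding energy_def by (auto intro!: derivative_eq_intros)
  then have "deriv (\<lambda>y. energy y - l s * y) z = -1"
    using assms by (simp add: DERIV_imp_deriv)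
  then show ?thesis by (simp add: force_dist_def subdifferential_dissip)
qed

text \<open>
  The normalization of the parametrization during the transition.
\<close>

lemma slopes_sum: "1 / (1 + real n / 2) + a_n n = 1"
proof -
  have "1 + real n / 2 \<noteq> 0" using of_nat_0_le_iff[of n] by linarith
  then show ?thesis unfolding a_n_def add_divide_distrib[symmetric] by (rule divide_self)
qed

lemma a_n_nonneg: "0 \<le> a_n n"
  by (simp add: a_n_def)

text \<open>
  The transition of parameter length \<open>1/2 + 1/n\<close> takes exactly the time \<open>1/n\<close> of the ramp of the load.
\<close>

lemma that_n_increment:
  assumes "n \<ge> 1"
  shows "1 / (1 + real n / 2) * (1/2 + 1 / real n) = 1 / real n"
proof -
  have "0 < real n * 4 + real n * (real n * 2)"
    using assms by (intro add_pos_pos mult_pos_pos) auto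
  then have "real n * 4 + real n * (real n * 2) \<noteq> 0" by (rule less_imp_neq[symmetric])
  then show ?thesis using assms by (simp add: field_simps)
qed

lemma zhat_n_broken_line:
  assumes "n \<ge> 1"
  shows "zhat_n n = broken_line 1 (3/2 + 1 / real n) 0 (a_n n) 0"
proof
  fix s
  have q: "1 \<le> 3/2 + 1 / real n" by (simp add: add_increasing2)
  have "a_n n * (1/2 + 1 / real n) = real n / 2 * (1 / (1 + real n / 2) * (1/2 + 1 / real n))"
    by (simp add: a_n_def)
  then have jump: "a_n n * (1/2 + 1 / real n) = 1/2"
    using assms unfolding that_n_increment[OF assms] by simp
  consider "s \<le> 1" | "1 < s" "s < 3/2 + 1 / real n" | "3/2 + 1 / real n \<le> s" by linarith
  then show "zhat_n n s = broken_line 1 (3/2 + 1 / real n) 0 (a_n n) 0 s"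
  proof cases
    case 1
    then show ?thesis by (simp add: zhat_n_def broken_line_cases(1)[OF q])
  next
    case 2
    then show ?thesis by (simp add: zhat_n_def broken_line_cases(2)[OF q] right_diff_distrib)
  next
    case 3
    have "0 < 1 / real n" using assms by simp
    then have "1 < s" using 3 by linarith
    then show ?thesis using 3 jump by (simp add: zhat_n_def broken_line_cases(3)[OF q])
  qed
qed

lemma that_n_broken_line:
  assumes "n \<ge> 1"
  shows "that_n n = broken_line 1 (3/2 + 1 / real n) 1 (1 / (1 + real n / 2)) 1"
proof
  fix s
  have q: "1 \<le> 3/2 + 1 / real n" by (simp add: add_increasing2)
  note jump = that_n_increment[OF assms]
  consider "s \<le> 1" | "1 < s" "s < 3/2 + 1 / real n" | "3/2 + 1 / real n \<le> s" by linarith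
  then show "that_n n s = broken_line 1 (3/2 + 1 / real n) 1 (1 / (1 + real n / 2)) 1 s"
  proof cases
    case 1
    then show ?thesis by (simp add: that_n_def broken_line_cases(1)[OF q])
  next
    case 2
    have "that_n n s = 1 / (1 + real n / 2) * s + (1 - 1 / (1 + real n / 2))"
      using 2 slopes_sum[of n] by (simp add: that_n_def)
    also have "\<dots> = 1 + 1 / (1 + real n / 2) * (s - 1)" by (simp add: algebra_simps diff_divide_distrib)
    finally show ?thesis using 2 by (simp add: broken_line_cases(2)[OF q])
  next
    case 3
    have "0 < 1 / real n" using assms by simp
    then have "1 < s" using 3 by linarith
    then show ?thesis using 3 jump by (simp add: that_n_def broken_line_cases(3)[OF q])
  qed
qed

lemma load_n_broken_line:
  assumes "n \<ge> 1"
  shows "load_n n = broken_line 1 (1 + 1 / real n) 0 (real n / 2) 0"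
proof
  fix t
  have q: "1 \<le> 1 + 1 / real n" by simp
  consider "t \<le> 1" | "1 < t" "t < 1 + 1 / real n" | "1 + 1 / real n \<le> t" by linarith
  then show "load_n n t = broken_line 1 (1 + 1 / real n) 0 (real n / 2) 0 t"
  proof cases
    case 1
    then show ?thesis by (simp add: load_n_def broken_line_cases(1)[OF q])
  next
    case 2
    then show ?thesis by (simp add: load_n_def broken_line_cases(2)[OF q] right_diff_distrib)
  next
    case 3
    have "0 < 1 / real n" using assms by simp
    then have "1 < t" using 3 by linarith
    then show ?thesis using 3 assms by (simp add: load_n_def broken_line_cases(3)[OF q])
  qed
qed

lemma zhat_lim_broken_line: "zhat_lim = broken_line 1 (3/2) 0 1 0"
  by (rule ext) (auto simp: zhat_lim_def broken_line_def min_def max_def)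

lemma that_lim_broken_line: "that_lim = broken_line 1 (3/2) 1 0 1"
  by (rule ext) (auto simp: that_lim_def broken_line_def min_def max_def)

text \<open>
  The parametrized load is the given load in the new time variable. As \<open>that_n\<close> is injective, this is
  all that the compatibility condition between the two loads requires.
\<close>

lemma load_n_that_n:
  assumes "n \<ge> 1"
  shows "load_n n (that_n n s) = lhat_n n s"
proof -
  define m where "m = 1 / (1 + real n / 2)"
  have q: "1 \<le> 3/2 + 1 / real n" by (simp add: add_increasing2)
  have m: "0 < m" by (simp add: m_def add_pos_nonneg)
  have jump: "m * (1/2 + 1 / real n) = 1 / real n"
    using that_n_increment[OF assms] by (simp only: m_def)
  have am: "a_n n = real n / 2 * m" by (simp add: m_def a_n_def)
  have n: "0 < 1 / real n" using assms by simp
  note that = that_n_broken_line[OF assms, folded m_def]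
  consider "s \<le> 1" | "1 < s" "s < 3/2 + 1 / real n" | "3/2 + 1 / real n \<le> s" by linarith
  then show ?thesis
  proof cases
    case 1
    then show ?thesis by (simp add: load_n_def lhat_n_def zhat_n_def that_n_def)
  next
    case 2
    have t: "that_n n s = 1 + m * (s - 1)" using 2 by (simp add: that broken_line_cases(2)[OF q])
    have "m * (s - 1) < m * (1/2 + 1 / real n)" using 2 m by (intro mult_strict_left_mono) auto
    moreover have "0 < m * (s - 1)" using 2 m by simp
    ultimately show ?thesis
      using 2 jump by (simp add: t load_n_def lhat_n_def zhat_n_def am algebra_simps)
  next
    case 3
    then have "1 < s" "1 < s - 1/2" using n by linarith+
    then show ?thesis using 3 by (simp add: load_n_def lhat_n_def zhat_n_def that_n_def)
  qed
qed

text \<open>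
  With vanishing distance term and \<open>z' \<ge> 0\<close> the dissipated energy is the increment of \<open>z\<close>, which cancels
  the linear part of the energy; its quadratic part is the work of the load \<open>l = z\<close>.
\<close>

lemma zhat_n_energy_balance:
  assumes n: "n \<ge> 1" and "s1 \<le> s2"
    and z': "z' = three_step 1 (3/2 + 1 / real n) 0 (a_n n) 0"
  shows "energy (zhat_n n s2) + interval_lebesgue_integral lebesgue (ereal s1) (ereal s2)
           (\<lambda>r. dissip (z' r) + \<bar>z' r\<bar> * force_dist energy dissip (lhat_n n) r (zhat_n n r))
         = energy (zhat_n n s1) + interval_lebesgue_integral lebesgue (ereal s1) (ereal s2)
             (\<lambda>r. lhat_n n r * z' r)"
proof -
  have q: "1 \<le> 3/2 + 1 / real n" by (simp add: add_increasing2)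
  interpret z: bounded_primitive s1 s2 "zhat_n n" z' "{1, 3/2 + 1 / real n}" "\<bar>0\<bar> + \<bar>a_n n\<bar> + \<bar>0\<bar>"
    unfolding z' zhat_n_broken_line[OF n] by (rule bounded_primitive_broken_line[OF q \<open>s1 \<le> s2\<close>])
  have "dissip (z' r) + \<bar>z' r\<bar> * force_dist energy dissip (lhat_n n) r (zhat_n n r) = z' r" for r
    by (simp add: force_dist_balanced lhat_n_def dissip_def z' three_step_nonneg a_n_nonneg)
  then show ?thesis
    unfolding interval_integral_Ioo[OF \<open>s1 \<le> s2\<close>] lhat_n_def
    by (simp add: z.integral_slope z.square_integral energy_def diff_divide_distrib lhat_n_def)
qed

lemma BV_solution_n:
  assumes n: "n \<ge> 1"
  shows "BV_solution 2 0 energy dissip (load_n n) (5/2) (that_n n) (zhat_n n) (lhat_n n)"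
  unfolding BV_solution_def
proof (intro conjI exI)
  define t' where "t' = three_step 1 (3/2 + 1 / real n) 1 (1 / (1 + real n / 2)) 1"
  define z' where "z' = three_step 1 (3/2 + 1 / real n) 0 (a_n n) 0"
  have q: "1 \<le> 3/2 + 1 / real n" by (simp add: add_increasing2)
  have n1: "1 / real n \<le> 1" using n by simp
  interpret t: bounded_primitive 0 "5/2" "that_n n" t' "{1, 3/2 + 1 / real n}" "\<bar>1\<bar> + \<bar>1 / (1 + real n / 2)\<bar> + \<bar>1\<bar>"
    unfolding t'_def that_n_broken_line[OF n] by (rule bounded_primitive_broken_line[OF q]) simp
  interpret z: bounded_primitive 0 "5/2" "zhat_n n" z' "{1, 3/2 + 1 / real n}" "\<bar>0\<bar> + \<bar>a_n n\<bar> + \<bar>0\<bar>"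
    unfolding z'_def zhat_n_broken_line[OF n] by (rule bounded_primitive_broken_line[OF q]) simp
  show "BV_on 0 2 (load_n n)" "BV_on 0 (5/2) (lhat_n n)"
    unfolding load_n_broken_line[OF n] lhat_n_def zhat_n_broken_line[OF n]
    by (auto intro!: BV_on_broken_line a_n_nonneg)
  show "W1inf_deriv (5/2) (that_n n) t'" "W1inf_deriv (5/2) (zhat_n n) z'"
    by (rule t.W1inf z.W1inf, rule refl)+
  show t0: "that_n n 0 = 0" and "zhat_n n 0 = 0" by (simp_all add: that_n_def zhat_n_def)
  show tS: "that_n n (5/2) = 2" using n1 by (simp add: that_n_def)
  have step: "t' s + z' s = 1" "0 \<le> t' s" "0 \<le> z' s" for s
    using slopes_sum[of n] a_n_nonneg[of n] by (auto simp: t'_def z'_def three_step_def)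
  show "AE s in lebesgue_on {0<..<5/2}. 0 \<le> t' s \<and>
      t' s * force_dist energy dissip (lhat_n n) s (zhat_n n s) = 0 \<and>
      t' s + dissip (z' s) + \<bar>z' s\<bar> * force_dist energy dissip (lhat_n n) s (zhat_n n s) = 1"
    using step by (intro AE_I2) (simp add: force_dist_balanced lhat_n_def dissip_def)
  show "\<forall>s1\<in>{0..5/2}. \<forall>s2\<in>{0..5/2}.
      energy (zhat_n n s2) + interval_lebesgue_integral lebesgue (ereal s1) (ereal s2)
        (\<lambda>r. dissip (z' r) + \<bar>z' r\<bar> * force_dist energy dissip (lhat_n n) r (zhat_n n r))
      = energy (zhat_n n s1) + interval_lebesgue_integral lebesgue (ereal s1) (ereal s2)
          (\<lambda>r. lhat_n n r * z' r)"
  proof (intro ballI)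
    fix s1 s2
    show "energy (zhat_n n s2) + interval_lebesgue_integral lebesgue (ereal s1) (ereal s2)
        (\<lambda>r. dissip (z' r) + \<bar>z' r\<bar> * force_dist energy dissip (lhat_n n) r (zhat_n n r))
      = energy (zhat_n n s1) + interval_lebesgue_integral lebesgue (ereal s1) (ereal s2)
          (\<lambda>r. lhat_n n r * z' r)"
    proof (cases "s1 \<le> s2")
      case True
      then show ?thesis by (rule zhat_n_energy_balance[OF n _ z'_def])
    next
      case False
      then have "s2 < s1" by simp
      from zhat_n_energy_balance[OF n less_imp_le[OF this] z'_def] show ?thesis
        unfolding interval_integral_swap[OF \<open>s2 < s1\<close>] by linarith
    qed
  qed
  show "\<forall>ts\<in>{0..2}. \<exists>ss\<in>{s \<in> {0..5/2}. that_n n s = ts}.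
      lhat_n n ss \<in> {load_n n ts, left_lim (load_n n) ts, right_lim 2 (load_n n) ts} \<and>
      (\<forall>s\<in>{s \<in> {0..5/2}. that_n n s = ts}.
         (s < ss \<longrightarrow> lhat_n n s = left_lim (load_n n) ts) \<and>
         (s > ss \<longrightarrow> lhat_n n s = right_lim 2 (load_n n) ts))"
  proof
    fix ts :: real assume ts: "ts \<in> {0..2}"
    have "\<exists>ss\<ge>0. ss \<le> 5/2 \<and> that_n n ss = ts"
      using ts t0 tS t.cont by (intro IVT') (auto intro: continuous_on_subset)
    then obtain ss where ss: "0 \<le> ss" "ss \<le> 5/2" "that_n n ss = ts" by blast
    have mono: "that_n n x < that_n n y" if "x < y" for x y
      unfolding that_n_broken_line[OF n] using that q
      by (intro broken_line_strict_mono) (auto simp: add_pos_nonneg)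
    have uniq: "s = ss" if "that_n n s = ts" for s
      using mono[of s ss] mono[of ss s] ss(3) that by (cases s ss rule: linorder_cases) auto
    have eq: "lhat_n n ss = load_n n ts" using load_n_that_n[OF n, of ss] ss(3) by simp
    show "\<exists>ss\<in>{s \<in> {0..5/2}. that_n n s = ts}.
      lhat_n n ss \<in> {load_n n ts, left_lim (load_n n) ts, right_lim 2 (load_n n) ts} \<and>
      (\<forall>s\<in>{s \<in> {0..5/2}. that_n n s = ts}.
         (s < ss \<longrightarrow> lhat_n n s = left_lim (load_n n) ts) \<and>
         (s > ss \<longrightarrow> lhat_n n s = right_lim 2 (load_n n) ts))"
    proof (intro bexI[of _ ss] conjI ballI)
      show "lhat_n n ss \<in> {load_n n ts, left_lim (load_n n) ts, right_lim 2 (load_n n) ts}"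
        unfolding eq by (rule insertI1)
      show "ss \<in> {s \<in> {0..5/2}. that_n n s = ts}" using ss by simp
      fix s assume "s \<in> {s \<in> {0..5/2}. that_n n s = ts}"
      then have "s = ss" by (intro uniq) simp
      then show "s < ss \<longrightarrow> lhat_n n s = left_lim (load_n n) ts"
        "s > ss \<longrightarrow> lhat_n n s = right_lim 2 (load_n n) ts"
        by simp_all
    qed
  qed
qed simp

section \<open>Convergence of the example and failure of the limit\<close>

lemma inverse_Suc: "(\<lambda>k. 1 / real (Suc k)) \<longlonglongrightarrow> 0"
  by (rule lim_inverse_n'[THEN LIMSEQ_Suc])

lemma a_n_conv: "(\<lambda>k. a_n (Suc k)) \<longlonglongrightarrow> 1"
  and m_n_conv: "(\<lambda>k. 1 / (1 + real (Suc k) / 2)) \<longlonglongrightarrow> 0"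
proof -
  show m: "(\<lambda>k. 1 / (1 + real (Suc k) / 2)) \<longlonglongrightarrow> 0"
    by real_asymp
  have "a_n (Suc k) = 1 - 1 / (1 + real (Suc k) / 2)" for k
    using slopes_sum[of "Suc k"] by simp
  then show "(\<lambda>k. a_n (Suc k)) \<longlonglongrightarrow> 1"
    using tendsto_diff[OF tendsto_const[of 1] m] by simp
qed

text \<open>
  In the limit the middle slope of \<open>zhat_n\<close> tends to 1 and that of \<open>that_n\<close> to 0: time stops while
  the state moves from 0 to \<open>1/2\<close>.
\<close>

lemma zhat_n_sequence: "broken_line_sequence (5/2) 1 (\<lambda>k. 3/2 + 1 / real (Suc k)) (\<lambda>k. a_n (Suc k)) (3/2) 1 1"
proof
  show "(\<lambda>k. 3/2 + 1 / real (Suc k)) \<longlonglongrightarrow> 3/2"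
    using tendsto_add[OF tendsto_const[of "3/2"] inverse_Suc] by simp
  show "\<bar>a_n (Suc k)\<bar> \<le> 1" for k
    using slopes_sum[of "Suc k"] a_n_nonneg[of "Suc k"] 
      by (smt (verit) divide_nonneg_nonneg of_nat_0_le_iff)
qed (use a_n_conv in auto)

lemma that_n_sequence:
  "broken_line_sequence (5/2) 1 (\<lambda>k. 3/2 + 1 / real (Suc k)) (\<lambda>k. 1 / (1 + real (Suc k) / 2)) (3/2) 0 1"
proof
  show "(\<lambda>k. 3/2 + 1 / real (Suc k)) \<longlonglongrightarrow> 3/2"
    using tendsto_add[OF tendsto_const[of "3/2"] inverse_Suc] by simp
  show "\<bar>1 / (1 + real (Suc k) / 2)\<bar> \<le> 1" for k
    by (simp add: field_simps)
qed (use m_n_conv in auto)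

lemma load_conv: "intermediate_conv 2 (\<lambda>k. load_n (Suc k)) load_lim"
proof -
  interpret steepening_ramp 2 1 "1/2" "\<lambda>k. 1 + 1 / real (Suc k)"
  proof
    show "(\<lambda>k. 1 + 1 / real (Suc k)) \<longlonglongrightarrow> 1"
      using tendsto_add[OF tendsto_const[of 1] inverse_Suc] by simp
  qed auto
  have "load_n (Suc k) = ramp k" for k
    using load_n_broken_line[of "Suc k"] by simp
  moreover have "load_lim = jump" by (rule ext) (simp add: load_lim_def)
  ultimately show ?thesis using ramp_intermediate_conv by simp
qed

lemma left_lim_load_lim: "left_lim load_lim 1 = 0"
proof -
  have "(load_lim \<longlongrightarrow> 0) (at_left 1)"
    by (rule tendsto_eventually) (auto simp: eventually_at_filter load_lim_def)
  then show ?thesis by (simp add: left_lim_def tendsto_Lim)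
qed

lemma right_lim_load_lim: "right_lim 2 load_lim 1 = 1/2"
proof -
  have "(load_lim \<longlongrightarrow> 1/2) (at_right 1)"
    by (rule tendsto_eventually) (auto simp: eventually_at_filter load_lim_def)
  then show ?thesis by (simp add: right_lim_def tendsto_Lim)
qed

text \<open>
  At the frozen time 1 the limit load \<open>lhat_lim\<close> passes continuously through all values between 0 and
  \<open>1/2\<close>, whereas the compatibility condition allows a value other than the one-sided limits of the
  load at a single parameter only. Two parameters inside the transition contradict it.
\<close>

lemma not_BV_solution_lim:
  "\<not> BV_solution 2 0 energy dissip load_lim (5/2) that_lim zhat_lim lhat_lim"
proof
  assume "BV_solution 2 0 energy dissip load_lim (5/2) that_lim zhat_lim lhat_lim"
  then have "\<forall>ts\<in>{0..2}. \<exists>ss\<in>{s \<in> {0..5/2}. that_lim s = ts}.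
      \<forall>s\<in>{s \<in> {0..5/2}. that_lim s = ts}.
         (s < ss \<longrightarrow> lhat_lim s = left_lim load_lim ts) \<and>
         (s > ss \<longrightarrow> lhat_lim s = right_lim 2 load_lim ts)"
    unfolding BV_solution_def by blast
  from bspec[OF this, of 1]
  have "\<exists>ss. \<forall>s\<in>{s \<in> {0..5/2}. that_lim s = 1}.
      (s < ss \<longrightarrow> lhat_lim s = 0) \<and> (s > ss \<longrightarrow> lhat_lim s = 1/2)"
    unfolding left_lim_load_lim right_lim_load_lim by fastforce
  then obtain ss where ss: "\<And>s. s \<in> {0..5/2} \<Longrightarrow> that_lim s = 1 \<Longrightarrow>
      (s < ss \<longrightarrow> lhat_lim s = 0) \<and> (s > ss \<longrightarrow> lhat_lim s = 1/2)"
    by blast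
  have "that_lim (5/4) = 1" "that_lim (11/8) = 1" "lhat_lim (5/4) = 1/4" "lhat_lim (11/8) = 3/8"
    by (simp_all add: that_lim_def lhat_lim_def zhat_lim_def)
  then show False using ss[of "5/4"] ss[of "11/8"] by auto
qed

theorem mainTheorem1:
  shows "intermediate_conv 2 (\<lambda>k. load_n (Suc k)) load_lim
    \<and> (\<forall>n\<ge>1. BV_solution 2 0 energy dissip (load_n n) (5/2) (that_n n) (zhat_n n) (lhat_n n))
    \<and> (H1_conv (5/2) (\<lambda>k. zhat_n (Suc k)) zhat_lim
       \<and> H1_conv (5/2) (\<lambda>k. that_n (Suc k)) that_lim
       \<and> W1inf_weak_star_conv (5/2) (\<lambda>k. zhat_n (Suc k)) zhat_lim
       \<and> W1inf_weak_star_conv (5/2) (\<lambda>k. that_n (Suc k)) that_lim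
       \<and> intermediate_conv (5/2) (\<lambda>k. lhat_n (Suc k)) lhat_lim)
    \<and> \<not> BV_solution 2 0 energy dissip load_lim (5/2) that_lim zhat_lim lhat_lim
    \<and> \<not> stable_intermediate 2 0 energy dissip"
proof -
  have z: "(\<lambda>k. zhat_n (Suc k)) = (\<lambda>k. broken_line 1 (3/2 + 1 / real (Suc k)) 0 (a_n (Suc k)) 0)"
    by (rule ext) (rule zhat_n_broken_line, simp)
  have t: "(\<lambda>k. that_n (Suc k)) = (\<lambda>k. broken_line 1 (3/2 + 1 / real (Suc k)) 1 (1 / (1 + real (Suc k) / 2)) 1)"
    by (rule ext) (rule that_n_broken_line, simp)
  have l: "(\<lambda>k. lhat_n (Suc k)) = (\<lambda>k. zhat_n (Suc k))" by (simp only: lhat_n_def)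
  have conv: "H1_conv (5/2) (\<lambda>k. zhat_n (Suc k)) zhat_lim"
    "H1_conv (5/2) (\<lambda>k. that_n (Suc k)) that_lim"
    "W1inf_weak_star_conv (5/2) (\<lambda>k. zhat_n (Suc k)) zhat_lim"
    "W1inf_weak_star_conv (5/2) (\<lambda>k. that_n (Suc k)) that_lim"
    "intermediate_conv (5/2) (\<lambda>k. lhat_n (Suc k)) lhat_lim"
    unfolding l lhat_lim_def z t zhat_lim_broken_line that_lim_broken_line
    by (intro broken_line_sequence.H1_conv[OF zhat_n_sequence] broken_line_sequence.H1_conv[OF that_n_sequence]
        broken_line_sequence.W1inf_weak_star_conv[OF zhat_n_sequence]
        broken_line_sequence.W1inf_weak_star_conv[OF that_n_sequence]
        broken_line_sequence.intermediate_conv[OF zhat_n_sequence] a_n_nonneg; simp)+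
  have "\<not> stable_intermediate 2 0 energy dissip"
  proof
    assume stable: "stable_intermediate 2 0 energy dissip"
    have "BV_solution 2 0 energy dissip load_lim (5/2) that_lim zhat_lim lhat_lim"
      by (rule stable[unfolded stable_intermediate_def, rule_format,
            where loads = "\<lambda>k. load_n (Suc k)" and ts = "\<lambda>k. that_n (Suc k)"
              and zs = "\<lambda>k. zhat_n (Suc k)" and ls = "\<lambda>k. lhat_n (Suc k)"])
        (intro conjI allI load_conv conv BV_solution_n; simp)
    with not_BV_solution_lim show False ..
  qed
  then show ?thesis using load_conv BV_solution_n conv not_BV_solution_lim by blast
qed

end
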